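(* Let $s>0$, let $f\in X^s$, let $\alpha,\beta>-1$, and let $E_n[f]=\int_{-1}^1 w(x)f(x)\,dx-I_n[f]$, where $I_n$ is any one of the following three $n$-point quadrature rules for the weight $w$: the Clenshaw-Curtis rule $I_n^{C\text{-}C}$, Fejér's first rule $I_n^{F_1}$, or Fejér's second rule $I_n^{F_2}$. Then, as $n\to\infty$: (1) for $w(x)=(1-x)^{\alpha}(1+x)^{\beta}$, $$E_n[f]=\begin{cases}O(n^{-s-1}) & \text{if } \min(\alpha,\beta)\ge-\frac12,\\ O(n^{-s-2-2\min(\alpha,\beta)}) & \text{if } -1<\min(\alpha,\beta)<-\frac12;\end{cases}$$ (2) for $w(x)=\ln\big((x+1)/2\big)(1-x)^{\alpha}(1+x)^{\beta}$, $$E_n[f]=\begin{cases}O(n^{-s-1}) & \text{if } \beta>-\frac12,\\ O(n^{-s-2-2\beta}\ln n) & \text{if } -1<\beta\le-\frac12.\end{cases}$$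
   Context: For $f$ on $[-1,1]$ the Chebyshev coefficients are $a_j=\frac{2}{\pi}\int_{-1}^1\frac{f(x)T_j(x)}{\sqrt{1-x^2}}\,dx$, where $T_j(x)=\cos(j\cos^{-1}x)$. One says $f\in X^s$ ($s>0$) if $a_j=O(j^{-s-1})$ as $j\to\infty$. Functions $f$ are assumed to be the sum of their uniformly convergent Chebyshev series, $f(x)=\frac{a_0}{2}+\sum_{j=1}^\infty a_jT_j(x)$ on $[-1,1]$ (equivalently, for $f\in X^s$, $f$ is continuous). Each of the three rules is interpolatory: $I_n[f]=\int_{-1}^1w(x)q_{n-1}(x)\,dx$, where $q_{n-1}$ is the polynomial of degree at most $n-1$ interpolating $f$ at $n$ nodes, namely: - Fejér's first rule $I_n^{F_1}$: nodes $\cos\big(\frac{(2j-1)\pi}{2n}\big)$, $j=1,\dots,n$ (zeros of $T_n$); - Fejér's second rule $I_n^{F_2}$: nodes $\cos\big(\frac{j\pi}{n+1}\big)$, $j=1,\dots,n$ (zeros of the second-kind Chebyshev polynomial $U_n$); - Clenshaw-Curtis rule $I_n^{C\text{-}C}$ ($n\ge2$): nodes $\cos\big(\frac{j\pi}{n-1}\big)$, $j=0,1,\dots,n-1$. *)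

theory Defs
  imports "HOL-Analysis.Analysis" "HOL-Library.Landau_Symbols"
    "HOL-Computational_Algebra.Polynomial"
begin

section \<open>Chebyshev series\<close>

text \<open>This formula is only meaningful on \<open>[-1, 1]\<close>, the only place where it is used.\<close>

definition cheb_T :: "nat \<Rightarrow> real \<Rightarrow> real" where
  "cheb_T j x = cos (real j * arccos x)"

definition cheb_coeff :: "(real \<Rightarrow> real) \<Rightarrow> nat \<Rightarrow> real" where
  "cheb_coeff f j = 2 / pi * (LINT x:{-1..1}|lborel. f x * cheb_T j x / sqrt (1 - x\<^sup>2))"

definition cheb_X :: "real \<Rightarrow> (real \<Rightarrow> real) set" where
  "cheb_X s = {f. cheb_coeff f \<in> O(\<lambda>j. real j powr (- s - 1))}"

definition is_cheb_series_sum :: "(real \<Rightarrow> real) \<Rightarrow> bool" where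
  "is_cheb_series_sum f \<longleftrightarrow>
     uniform_limit {-1..1}
       (\<lambda>N x. cheb_coeff f 0 / 2 + (\<Sum>j=1..N. cheb_coeff f j * cheb_T j x)) f sequentially"


section \<open>Interpolatory quadrature rules\<close>

definition interp_poly :: "nat \<Rightarrow> real set \<Rightarrow> (real \<Rightarrow> real) \<Rightarrow> real poly" where
  "interp_poly n X f = (THE q. degree q \<le> n - 1 \<and> (\<forall>x\<in>X. poly q x = f x))"

text \<open>A rule takes the weight, the number \<open>n\<close> of nodes and the integrand.\<close>

definition interp_rule ::
    "(nat \<Rightarrow> real set) \<Rightarrow> (real \<Rightarrow> real) \<Rightarrow> nat \<Rightarrow> (real \<Rightarrow> real) \<Rightarrow> real" where
  "interp_rule nodes w n f = (LINT x:{-1..1}|lborel. w x * poly (interp_poly n (nodes n) f) x)"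

definition fejer1_nodes :: "nat \<Rightarrow> real set" where
  "fejer1_nodes n = (\<lambda>j. cos ((2 * real j - 1) * pi / (2 * real n))) ` {1..n}"

definition fejer2_nodes :: "nat \<Rightarrow> real set" where
  "fejer2_nodes n = (\<lambda>j. cos (real j * pi / (real n + 1))) ` {1..n}"

text \<open>Intended for \<open>n \<ge> 2\<close>.\<close>

definition clenshaw_curtis_nodes :: "nat \<Rightarrow> real set" where
  "clenshaw_curtis_nodes n = (\<lambda>j. cos (real j * pi / (real n - 1))) ` {0..n - 1}"

definition fejer1 :: "(real \<Rightarrow> real) \<Rightarrow> nat \<Rightarrow> (real \<Rightarrow> real) \<Rightarrow> real" where
  "fejer1 = interp_rule fejer1_nodes"

definition fejer2 :: "(real \<Rightarrow> real) \<Rightarrow> nat \<Rightarrow> (real \<Rightarrow> real) \<Rightarrow> real" where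
  "fejer2 = interp_rule fejer2_nodes"

definition clenshaw_curtis :: "(real \<Rightarrow> real) \<Rightarrow> nat \<Rightarrow> (real \<Rightarrow> real) \<Rightarrow> real" where
  "clenshaw_curtis = interp_rule clenshaw_curtis_nodes"

definition quad_error ::
    "((real \<Rightarrow> real) \<Rightarrow> nat \<Rightarrow> (real \<Rightarrow> real) \<Rightarrow> real) \<Rightarrow> (real \<Rightarrow> real) \<Rightarrow> (real \<Rightarrow> real) \<Rightarrow> nat \<Rightarrow> real"
  where
  "quad_error I w f n = (LINT x:{-1..1}|lborel. w x * f x) - I w n f"


section \<open>Weights\<close>

text \<open>The values at the endpoints \<open>\<plusminus>1\<close>, where \<open>0 powr a = 0\<close> and \<open>ln 0 = 0\<close>, are irrelevant
  to the integrals.\<close>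

definition jacobi_weight :: "real \<Rightarrow> real \<Rightarrow> real \<Rightarrow> real" where
  "jacobi_weight \<alpha> \<beta> x = (1 - x) powr \<alpha> * (1 + x) powr \<beta>"

definition log_jacobi_weight :: "real \<Rightarrow> real \<Rightarrow> real \<Rightarrow> real" where
  "log_jacobi_weight \<alpha> \<beta> x = ln ((x + 1) / 2) * (1 - x) powr \<alpha> * (1 + x) powr \<beta>"


section \<open>Well-definedness of the interpolating polynomial\<close>

lemma interp_poly_ex1:
  fixes X :: "real set"
  assumes "card X = n" "n \<ge> 1"
  shows "\<exists>!q. degree q \<le> n - 1 \<and> (\<forall>x\<in>X. poly q x = f x)"
proof (rule ex_ex1I)
  have fin: "finite X"
    using assms by (metis card.infinite not_one_le_zero)
  define L where "L y = (\<Prod>z\<in>X - {y}. [:- z, 1:])" for y :: real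
  define q where "q = (\<Sum>y\<in>X. smult (f y / poly (L y) y) (L y))"
  have L_other: "poly (L y) x = 0" if "x \<in> X" "x \<noteq> y" for x y
    using that fin by (auto simp: L_def poly_prod)
  have L_same: "poly (L y) y \<noteq> 0" for y
    using fin by (auto simp: L_def poly_prod)
  have "poly q x = f x" if "x \<in> X" for x
  proof -
    have "poly q x = (\<Sum>y\<in>X. if y = x then f x else 0)"
      unfolding q_def poly_sum
      by (rule sum.cong) (use that L_other L_same in auto)
    also have "\<dots> = f x"
      using fin that by simp
    finally show ?thesis .
  qed
  moreover have "degree q \<le> n - 1"
    unfolding q_def
  proof (rule degree_sum_le[OF fin])
    fix y assume y: "y \<in> X"
    have "degree (L y) \<le> (\<Sum>z\<in>X - {y}. 1)"
      unfolding L_def by (rule order.trans[OF degree_prod_sum_le]) (use fin in auto)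
    also have "\<dots> = n - 1"
      using y fin assms(1) by simp
    finally show "degree (smult (f y / poly (L y) y) (L y)) \<le> n - 1"
      using degree_smult_le order.trans by blast
  qed
  ultimately show "\<exists>q. degree q \<le> n - 1 \<and> (\<forall>x\<in>X. poly q x = f x)"
    by blast
next
  fix p q :: "real poly"
  assume p: "degree p \<le> n - 1 \<and> (\<forall>x\<in>X. poly p x = f x)"
    and q: "degree q \<le> n - 1 \<and> (\<forall>x\<in>X. poly q x = f x)"
  show "p = q"
  proof (rule ccontr)
    assume "p \<noteq> q"
    then have nz: "p - q \<noteq> 0"
      by simp
    have "X \<subseteq> {x. poly (p - q) x = 0}"
      using p q by auto
    then have "n \<le> card {x. poly (p - q) x = 0}"
      using assms(1) card_mono[OF poly_roots_finite[OF nz]] by blast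
    also have "\<dots> \<le> degree (p - q)"
      by (rule card_poly_roots_bound[OF nz])
    also have "\<dots> \<le> n - 1"
      using p q by (intro degree_diff_le) auto
    finally show False
      using assms(2) by simp
  qed
qed

lemma card_fejer1_nodes: "card (fejer1_nodes n) = n"
proof -
  have "inj_on (\<lambda>j. cos ((2 * real j - 1) * pi / (2 * real n))) {1..n}"
  proof (rule inj_onI)
    fix i j assume ij: "i \<in> {1..n}" "j \<in> {1..n}"
      and eq: "cos ((2 * real i - 1) * pi / (2 * real n)) = cos ((2 * real j - 1) * pi / (2 * real n))"
    have "(2 * real k - 1) * pi / (2 * real n) \<in> {0..pi}" if "k \<in> {1..n}" for k
    proof -
      have "(2 * real k - 1) * pi \<le> (2 * real n) * pi"
        using that by (intro mult_right_mono) auto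
      then show ?thesis
        using that by (simp add: divide_le_eq mult.commute)
    qed
    with ij eq have "(2 * real i - 1) * pi / (2 * real n) = (2 * real j - 1) * pi / (2 * real n)"
      using cos_inj_pi by (metis atLeastAtMost_iff)
    then show "i = j"
      using ij by (auto simp: field_simps)
  qed
  then show ?thesis
    by (simp add: fejer1_nodes_def card_image)
qed

lemma card_fejer2_nodes: "card (fejer2_nodes n) = n"
proof -
  have "inj_on (\<lambda>j. cos (real j * pi / (real n + 1))) {1..n}"
  proof (rule inj_onI)
    fix i j assume ij: "i \<in> {1..n}" "j \<in> {1..n}"
      and eq: "cos (real i * pi / (real n + 1)) = cos (real j * pi / (real n + 1))"
    have "real k * pi / (real n + 1) \<in> {0..pi}" if "k \<in> {1..n}" for k
    proof -
      have "real k * pi \<le> (real n + 1) * pi"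
        using that by (intro mult_right_mono) auto
      then show ?thesis
        using that by (simp add: divide_le_eq mult.commute)
    qed
    with ij eq have "real i * pi / (real n + 1) = real j * pi / (real n + 1)"
      using cos_inj_pi by (metis atLeastAtMost_iff)
    then show "i = j"
      by (auto simp: field_simps)
  qed
  then show ?thesis
    by (simp add: fejer2_nodes_def card_image)
qed

lemma card_clenshaw_curtis_nodes:
  assumes "n \<ge> 2"
  shows "card (clenshaw_curtis_nodes n) = n"
proof -
  have pos: "real n - 1 > 0"
    using assms by simp
  have "inj_on (\<lambda>j. cos (real j * pi / (real n - 1))) {0..n - 1}"
  proof (rule inj_onI)
    fix i j assume ij: "i \<in> {0..n - 1}" "j \<in> {0..n - 1}"
      and eq: "cos (real i * pi / (real n - 1)) = cos (real j * pi / (real n - 1))"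
    have "real k * pi / (real n - 1) \<in> {0..pi}" if "k \<in> {0..n - 1}" for k
    proof -
      have "real k \<le> real n - 1"
        using that assms by auto
      then have "real k * pi \<le> (real n - 1) * pi"
        by (intro mult_right_mono) auto
      then show ?thesis
        using pos by (simp add: divide_le_eq mult.commute)
    qed
    with ij eq have "real i * pi / (real n - 1) = real j * pi / (real n - 1)"
      using cos_inj_pi by (metis atLeastAtMost_iff)
    then show "i = j"
      using pos by simp
  qed
  then show ?thesis
    using assms by (simp add: clenshaw_curtis_nodes_def card_image)
qed

end

theory Submission
  imports Defs
begin

text \<open>Write \<open>M\<^sub>j = \<integral> w T\<^sub>j\<close> for the Chebyshev moments of the weight and \<open>a\<^sub>j\<close> for the coefficients of \<open>f\<close>.
Since the Chebyshev series of \<open>f\<close> converges uniformly, the error is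
\<open>\<Sum>\<^sub>j a\<^sub>j (M\<^sub>j - I\<^sub>n[T\<^sub>j])\<close>, and the terms with \<open>j < n\<close> vanish because the rule is exact there.
For \<open>j \<ge> n\<close> aliasing takes over: on the nodes, \<open>T\<^sub>j\<close> depends up to a sign only on \<open>j\<close> modulo \<open>2N\<close> and on
reflection at \<open>N\<close>, where \<open>N\<close> is \<open>n - 1\<close>, \<open>n\<close> or \<open>n + 1\<close>. Hence \<open>\<bar>I\<^sub>n[T\<^sub>j]\<bar>\<close>, summed over
a period, is at most \<open>8 (\<bar>M\<^sub>0\<bar> + \<dots> + \<bar>M\<^sub>n\<^sub>-\<^sub>1\<bar>)\<close> (\<open>rule_aliasing\<close>). With \<open>a\<^sub>j = O(j powr (-s-1))\<close> this gives
(\<open>quad_error_le\<close>), up to a constant factor,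
\<open>\<bar>E\<^sub>n[f]\<bar> \<le> n powr (-s-1) * (\<bar>M\<^sub>0\<bar> + \<dots> + \<bar>M\<^sub>n\<^sub>-\<^sub>1\<bar> + n * (sup\<^sub>j\<^sub>\<ge>\<^sub>n \<bar>M\<^sub>j\<bar>))\<close>,
so that everything depends on how fast the moments decay.

The substitution \<open>x = cos (2t)\<close> turns \<open>M\<^sub>m\<close> into a cosine integral over \<open>[0, \<pi>/2]\<close> of
\<open>G = sin\<^sup>a cos\<^sup>b\<close>, times \<open>ln cos\<close> for the logarithmic weight, where \<open>a = 2\<alpha> + 1\<close> and \<open>b = 2\<beta> + 1\<close>.
If \<open>G''\<close> is of order \<open>t powr (\<kappa> - 2)\<close> at both ends, with \<open>-1 < \<kappa> < 1\<close>, two integrations by parts give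
\<open>M\<^sub>m = O(m powr (-1 - \<kappa>))\<close> (\<open>cosine_integral_bound\<close>). For the Jacobi weight one may take \<open>\<kappa>\<close> to be the smaller
of \<open>a\<close> and \<open>b\<close>, cut off at \<open>1/2\<close>, except that an exponent equal to \<open>0\<close> is no singularity at all and
may be ignored. This exception is what keeps a logarithm out of the estimate at \<open>min \<alpha> \<beta> = -1/2\<close>.
For the logarithmic weight, the factor \<open>ln cos\<close> vanishes to second order at \<open>t = 0\<close>, so \<open>\<alpha>\<close> drops
out; at \<open>t = \<pi>/2\<close> it costs a logarithm. If \<open>b < 0\<close> that logarithm is traded for a small power by
\<open>ln (1/t) \<le> t powr (-\<eta>) / \<eta>\<close>, and \<open>\<eta> = 1 / ln m\<close> turns the loss back into a factor \<open>ln m\<close>; for this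
choice all bounds are kept explicit in \<open>\<kappa>\<close> and \<open>\<eta>\<close>. If \<open>b = 0\<close> the second derivative of \<open>G\<close> has order
exactly \<open>-2\<close>, the moments are \<open>O(1/m)\<close>, and their sum contributes the factor \<open>ln n\<close>.\<close>

section \<open>Cosine integrals near a singular endpoint\<close>

lemma one_minus_cos_le: "\<bar>1 - cos x\<bar> \<le> x\<^sup>2 / 2" for x :: real
proof -
  have "1 - cos x = 2 * (sin (x / 2))\<^sup>2"
    using cos_double_sin[of "x / 2"] by simp
  moreover have "(sin (x / 2))\<^sup>2 \<le> (x / 2)\<^sup>2"
    using abs_sin_x_le_abs_x[of "x / 2"] by (subst (asm) abs_le_square_iff)
  ultimately show ?thesis
    by (simp add: power_divide)
qed

text \<open>The second antiderivative \<open>(1 - cos (l t)) / l\<^sup>2\<close> of \<open>cos (l t)\<close> and its derivative \<open>sin (l t) / l\<close> vanish at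
\<open>0\<close> to orders two and one. They therefore outweigh \<open>h'\<close> and \<open>h\<close> there, and no boundary term survives at
the singular end as long as \<open>\<rho> > -1\<close>.\<close>

lemma cos_integral_by_parts_twice:
  fixes h h' h'' :: "real \<Rightarrow> real"
  assumes c: "c > 0" and l: "l > 0" and \<rho>: "\<rho> > - 1"
    and dh: "\<And>t. t \<in> {0<..c} \<Longrightarrow> (h has_real_derivative h' t) (at t)"
    and dh': "\<And>t. t \<in> {0<..c} \<Longrightarrow> (h' has_real_derivative h'' t) (at t)"
    and hb: "\<And>t. t \<in> {0<..c} \<Longrightarrow> \<bar>h t\<bar> \<le> D * t powr \<rho>"
    and hb': "\<And>t. t \<in> {0<..c} \<Longrightarrow> \<bar>h' t\<bar> \<le> D * t powr (\<rho> - 1)"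
  shows "((\<lambda>t. h t * cos (l * t) - h'' t * (1 - cos (l * t)) / l\<^sup>2) has_integral
          (h c * sin (l * c) / l - h' c * (1 - cos (l * c)) / l\<^sup>2)) {0..c}"
proof -
  define F where "F t = h t * sin (l * t) / l - h' t * (1 - cos (l * t)) / l\<^sup>2" for t
  have der: "(F has_real_derivative h t * cos (l * t) - h'' t * (1 - cos (l * t)) / l\<^sup>2) (at t)"
    if "t \<in> {0<..c}" for t
    unfolding F_def
    using l by (auto intro!: derivative_eq_intros dh[OF that] dh'[OF that]
        simp: field_simps power2_eq_square)
  have "((\<lambda>t. 2 * D * t powr (\<rho> + 1)) \<longlongrightarrow> 2 * D * 0) (at_right 0)"
  proof (intro tendsto_mult tendsto_const)
    show "((\<lambda>t. t powr (\<rho> + 1)) \<longlongrightarrow> 0) (at_right (0::real))"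
      using \<rho> by (intro tendsto_zero_powrI[where b = "\<rho> + 1"] tendsto_const)
        (auto simp: eventually_at_filter intro: tendsto_ident_at)
  qed
  moreover have "\<forall>\<^sub>F t in at_right 0. norm (F t) \<le> 2 * D * t powr (\<rho> + 1)"
  proof -
    have "norm (F t) \<le> 2 * D * t powr (\<rho> + 1)" if t: "0 < t" "t < c" for t
    proof -
      have t': "t \<in> {0<..c}" using t by auto
      have D: "0 \<le> D"
        using hb[OF t'] t by (smt (verit) mult_neg_pos powr_gt_zero)
      have "\<bar>sin (l * t)\<bar> \<le> l * t"
        using abs_sin_x_le_abs_x[of "l * t"] l t by simp
      hence "\<bar>sin (l * t) / l\<bar> \<le> t"
        using l by (simp add: abs_mult field_simps)
      hence "\<bar>h t\<bar> * \<bar>sin (l * t) / l\<bar> \<le> D * t powr \<rho> * t"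
        by (intro mult_mono hb t') (use D in auto)
      also have "\<dots> = D * t powr (\<rho> + 1)"
        using t by (simp add: powr_add)
      finally have 1: "\<bar>h t * sin (l * t) / l\<bar> \<le> D * t powr (\<rho> + 1)"
        by (simp add: abs_mult abs_divide)
      have "\<bar>(1 - cos (l * t)) / l\<^sup>2\<bar> \<le> t\<^sup>2"
      proof -
        have "\<bar>(1 - cos (l * t)) / l\<^sup>2\<bar> = \<bar>1 - cos (l * t)\<bar> / l\<^sup>2" by simp
        also have "\<dots> \<le> ((l * t)\<^sup>2 / 2) / l\<^sup>2"
          by (intro divide_right_mono one_minus_cos_le) auto
        also have "\<dots> \<le> t\<^sup>2" using l by (simp add: power_mult_distrib)
        finally show ?thesis .
      qed
      hence "\<bar>h' t\<bar> * \<bar>(1 - cos (l * t)) / l\<^sup>2\<bar> \<le> D * t powr (\<rho> - 1) * t\<^sup>2"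
        by (intro mult_mono hb' t') (use D in auto)
      also have "\<dots> = D * t powr (\<rho> + 1)"
        using t by (simp add: powr_diff powr_add power2_eq_square field_simps)
      finally have 2: "\<bar>h' t * (1 - cos (l * t)) / l\<^sup>2\<bar> \<le> D * t powr (\<rho> + 1)"
        by (simp add: abs_mult abs_divide)
      show ?thesis
        unfolding F_def real_norm_def using 1 2 by (intro order.trans[OF abs_triangle_ineq4]) simp
    qed
    thus ?thesis unfolding eventually_at_right_field using c by (intro exI[of _ c]) simp
  qed
  ultimately have "(F \<longlongrightarrow> 0) (at_right 0)"
    using Lim_null_comparison[of F "\<lambda>t. 2 * D * t powr (\<rho> + 1)" "at_right 0"] by simp
  moreover have F0: "F 0 = 0" by (simp add: F_def)
  ultimately have "continuous (at 0 within {0..c}) F"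
    using c by (simp add: continuous_within at_within_Icc_at_right)
  moreover have "continuous (at t within {0..c}) F" if "t \<in> {0<..c}" for t
    by (rule continuous_at_imp_continuous_within[OF DERIV_isCont[OF der[OF that]]])
  ultimately have cont: "continuous_on {0..c} F"
    unfolding continuous_on_eq_continuous_within by (metis atLeastAtMost_iff greaterThanAtMost_iff order_le_less)
  have "((\<lambda>t. h t * cos (l * t) - h'' t * (1 - cos (l * t)) / l\<^sup>2) has_integral (F c - F 0)) {0..c}"
  proof (rule fundamental_theorem_of_calculus_interior[OF _ cont])
    fix t assume "t \<in> {0<..<c}"
    thus "(F has_vector_derivative h t * cos (l * t) - h'' t * (1 - cos (l * t)) / l\<^sup>2) (at t)"
      unfolding has_real_derivative_iff_has_vector_derivative[symmetric] by (intro der) auto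
  qed (use c in simp)
  thus ?thesis using F0 by (simp add: F_def)
qed

text \<open>The kernel \<open>(1 - cos (l t)) / l\<^sup>2\<close> is bounded by \<open>t\<^sup>2 / 2\<close>, which is used for \<open>t \<le> 1/l\<close>, and by
\<open>2 / l\<^sup>2\<close>, which is used beyond. Integrating \<open>t powr (\<kappa> - 2)\<close> against these gives the power
\<open>l powr (-1 - \<kappa>)\<close> on either part; convergence at \<open>0\<close> needs \<open>\<kappa> > -1\<close>, and \<open>\<kappa> < 1\<close> makes the far part
dominated by its lower limit. The constant is explicit since \<open>\<kappa>\<close> may have to vary with \<open>l\<close>.\<close>

lemma endpoint_cos_integral_estimate:
  fixes h h' h'' :: "real \<Rightarrow> real"
  assumes c: "c > 0" and l: "1 / l \<le> c" "l > 0" and \<rho>: "\<rho> > - 1" and \<kappa>: "- 1 < \<kappa>" "\<kappa> < 1"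
    and dh: "\<And>t. t \<in> {0<..c} \<Longrightarrow> (h has_real_derivative h' t) (at t)"
    and dh': "\<And>t. t \<in> {0<..c} \<Longrightarrow> (h' has_real_derivative h'' t) (at t)"
    and hb: "\<And>t. t \<in> {0<..c} \<Longrightarrow> \<bar>h t\<bar> \<le> D * t powr \<rho>"
    and hb': "\<And>t. t \<in> {0<..c} \<Longrightarrow> \<bar>h' t\<bar> \<le> D * t powr (\<rho> - 1)"
    and hb'': "\<And>t. t \<in> {0<..c} \<Longrightarrow> \<bar>h'' t\<bar> \<le> B * t powr (\<kappa> - 2)"
    and int: "(\<lambda>t. h t * cos (l * t)) integrable_on {0..c}"
  shows "\<bar>integral {0..c} (\<lambda>t. h t * cos (l * t))
            - (h c * sin (l * c) / l - h' c * (1 - cos (l * c)) / l\<^sup>2)\<bar>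
         \<le> B * (1 / (1 + \<kappa>) + 2 / (1 - \<kappa>)) * l powr (- 1 - \<kappa>)"
proof -
  define Fc where "Fc = h c * sin (l * c) / l - h' c * (1 - cos (l * c)) / l\<^sup>2"
  define q where "q t = h'' t * (1 - cos (l * t)) / l\<^sup>2" for t
  define e where "e = 1 / l"
  have e: "0 < e" "e \<le> c" using l by (auto simp: e_def)
  have B: "0 \<le> B"
    using hb''[of c] c by (smt (verit) greaterThanAtMost_iff mult_neg_pos powr_gt_zero)
  have FI: "((\<lambda>t. h t * cos (l * t) - q t) has_integral Fc) {0..c}"
    unfolding q_def Fc_def by (rule cos_integral_by_parts_twice[OF c l(2) \<rho> dh dh' hb hb'])
  have qi: "q integrable_on {0..c}"
    using integrable_diff[OF int has_integral_integrable[OF FI]] by simp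
  have eq: "integral {0..c} (\<lambda>t. h t * cos (l * t)) - Fc = integral {0..c} q"
    using integral_diff[OF int has_integral_integrable[OF FI]] integral_unique[OF FI] by simp
  have split: "integral {0..c} q = integral {0..e} q + integral {e..c} q"
    using Henstock_Kurzweil_Integration.integral_combine[of 0 e c q] e qi by simp
  have qi1: "q integrable_on {0..e}" and qi2: "q integrable_on {e..c}"
    using integrable_subinterval_real[OF qi] e by auto
  have i1: "((\<lambda>t. (B / 2) * t powr \<kappa>) has_integral (B / 2) * (e powr (\<kappa> + 1) / (\<kappa> + 1))) {0..e}"
    using has_integral_powr_from_0[of \<kappa> e] e \<kappa> by (intro has_integral_mult_right) auto
  have b1: "norm (q t) \<le> (B / 2) * t powr \<kappa>" if "t \<in> {0..e}" for t
  proof (cases "t = 0")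
    case False
    hence t: "t \<in> {0<..c}" "0 < t" using that e by auto
    have "norm (q t) = \<bar>h'' t\<bar> * (\<bar>1 - cos (l * t)\<bar> / l\<^sup>2)"
      by (simp add: q_def abs_mult)
    also have "\<dots> \<le> (B * t powr (\<kappa> - 2)) * (((l * t)\<^sup>2 / 2) / l\<^sup>2)"
      by (intro mult_mono hb'' t divide_right_mono one_minus_cos_le) (use B in auto)
    also have "\<dots> = (B / 2) * t powr \<kappa>"
      using t l by (simp add: powr_diff powr_add power_mult_distrib field_simps)
    finally show ?thesis .
  qed (simp add: q_def)
  have 1: "norm (integral {0..e} q) \<le> (B / 2) * (e powr (\<kappa> + 1) / (\<kappa> + 1))"
    using Henstock_Kurzweil_Integration.integral_norm_bound_integral[OF qi1 has_integral_integrable[OF i1] b1]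
    unfolding integral_unique[OF i1] .
  have i2: "((\<lambda>t. t powr (\<kappa> - 2)) has_integral (c powr (\<kappa> - 1) / (\<kappa> - 1) - e powr (\<kappa> - 1) / (\<kappa> - 1))) {e..c}"
  proof (rule fundamental_theorem_of_calculus)
    fix t assume t: "t \<in> {e..c}"
    have "((\<lambda>t. t powr (\<kappa> - 1) / (\<kappa> - 1)) has_real_derivative
        ((\<kappa> - 1) * t powr (\<kappa> - 1 - 1)) / (\<kappa> - 1)) (at t)"
      using t e by (intro DERIV_cdivide has_real_derivative_powr) auto
    moreover have "((\<kappa> - 1) * t powr (\<kappa> - 1 - 1)) / (\<kappa> - 1) = t powr (\<kappa> - 2)"
      using \<kappa> by simp
    ultimately have "((\<lambda>t. t powr (\<kappa> - 1) / (\<kappa> - 1)) has_real_derivative t powr (\<kappa> - 2)) (at t)"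
      by simp
    thus "((\<lambda>t. t powr (\<kappa> - 1) / (\<kappa> - 1)) has_vector_derivative t powr (\<kappa> - 2)) (at t within {e..c})"
      unfolding has_real_derivative_iff_has_vector_derivative
      by (rule has_vector_derivative_at_within)
  qed (use e in auto)
  have i2': "((\<lambda>t. 2 * B / l\<^sup>2 * t powr (\<kappa> - 2)) has_integral
      2 * B / l\<^sup>2 * (c powr (\<kappa> - 1) / (\<kappa> - 1) - e powr (\<kappa> - 1) / (\<kappa> - 1))) {e..c}"
    by (rule has_integral_mult_right[OF i2])
  have b2: "norm (q t) \<le> 2 * B / l\<^sup>2 * t powr (\<kappa> - 2)" if "t \<in> {e..c}" for t
  proof -
    have t: "t \<in> {0<..c}" using that e by auto
    have "norm (q t) = \<bar>h'' t\<bar> * (\<bar>1 - cos (l * t)\<bar> / l\<^sup>2)"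
      by (simp add: q_def abs_mult)
    also have "\<dots> \<le> (B * t powr (\<kappa> - 2)) * (2 / l\<^sup>2)"
    proof (intro mult_mono hb'' t divide_right_mono)
      show "\<bar>1 - cos (l * t)\<bar> \<le> 2" using cos_ge_minus_one[of "l * t"] cos_le_one[of "l * t"] by linarith
    qed (use B in auto)
    finally show ?thesis by (simp add: mult_ac)
  qed
  have 2: "norm (integral {e..c} q) \<le> 2 * B / l\<^sup>2 * (c powr (\<kappa> - 1) / (\<kappa> - 1) - e powr (\<kappa> - 1) / (\<kappa> - 1))"
    using Henstock_Kurzweil_Integration.integral_norm_bound_integral[OF qi2 has_integral_integrable[OF i2'] b2]
    unfolding integral_unique[OF i2'] .
  also have "\<dots> \<le> 2 * B / l\<^sup>2 * (e powr (\<kappa> - 1) / (1 - \<kappa>))"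
  proof (rule mult_left_mono)
    have "c powr (\<kappa> - 1) / (\<kappa> - 1) \<le> 0" using \<kappa> by (simp add: divide_nonneg_neg)
    moreover have "e powr (\<kappa> - 1) / (\<kappa> - 1) = - (e powr (\<kappa> - 1) / (1 - \<kappa>))"
      using \<kappa> by (simp add: field_simps)
    ultimately show "c powr (\<kappa> - 1) / (\<kappa> - 1) - e powr (\<kappa> - 1) / (\<kappa> - 1) \<le> e powr (\<kappa> - 1) / (1 - \<kappa>)"
      by linarith
  qed (use B in auto)
  also have "\<dots> = B * (2 / (1 - \<kappa>)) * l powr (- 1 - \<kappa>)"
  proof -
    have "e powr (\<kappa> - 1) / l\<^sup>2 = l powr (- 1 - \<kappa>)"
      using l by (simp add: e_def powr_divide powr_diff powr_minus power2_eq_square field_simps)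
    moreover have "2 * B / l\<^sup>2 * (E / (1 - \<kappa>)) = B * (2 / (1 - \<kappa>)) * (E / l\<^sup>2)" for E
      by (simp add: mult_ac)
    ultimately show ?thesis by metis
  qed
  finally have 2: "norm (integral {e..c} q) \<le> B * (2 / (1 - \<kappa>)) * l powr (- 1 - \<kappa>)" .
  have "(B / 2) * (e powr (\<kappa> + 1) / (\<kappa> + 1)) \<le> B * (1 / (1 + \<kappa>)) * l powr (- 1 - \<kappa>)"
  proof -
    define Y where "Y = B * (1 / (1 + \<kappa>)) * l powr (- 1 - \<kappa>)"
    have E: "e powr (\<kappa> + 1) = l powr (- 1 - \<kappa>)"
      using l by (simp add: e_def powr_divide powr_diff powr_add powr_minus field_simps)
    have "(B / 2) * (e powr (\<kappa> + 1) / (\<kappa> + 1)) = Y / 2"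
      unfolding E Y_def by (simp add: add.commute)
    moreover have "0 \<le> Y" unfolding Y_def using B \<kappa> by simp
    ultimately have "(B / 2) * (e powr (\<kappa> + 1) / (\<kappa> + 1)) \<le> Y" by linarith
    thus ?thesis unfolding Y_def .
  qed
  hence "norm (integral {0..c} q) \<le> B * (1 / (1 + \<kappa>)) * l powr (- 1 - \<kappa>) + B * (2 / (1 - \<kappa>)) * l powr (- 1 - \<kappa>)"
    unfolding split using 1 2 by (intro order.trans[OF norm_triangle_ineq]) simp
  thus ?thesis unfolding eq[symmetric] Fc_def[symmetric] by (simp add: algebra_simps)
qed

section \<open>Products of powers of sine and cosine\<close>

lemma cos_ge_half: "1 / 2 \<le> cos t" if "t \<in> {0..pi/4}" for t :: real
proof -
  have "cos (pi / 3) \<le> cos t"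
    by (rule cos_monotone_0_pi_le) (use that pi_gt_zero in auto)
  thus ?thesis by (simp add: cos_60)
qed

lemma half_le_sin: "t / 2 \<le> sin t" if "t \<in> {0..pi/4}" for t :: real
proof -
  have "(\<lambda>t. sin t - t / 2) 0 \<le> (\<lambda>t. sin t - t / 2) t"
  proof (rule DERIV_nonneg_imp_nondecreasing[of 0 t "\<lambda>t. sin t - t / 2"])
    fix x assume x: "0 \<le> x" "x \<le> t"
    have "((\<lambda>t. sin t - t / 2) has_real_derivative (cos x - 1 / 2)) (at x)"
      by (auto intro!: derivative_eq_intros)
    moreover have "0 \<le> cos x - 1 / 2" using cos_ge_half[of x] x that by auto
    ultimately show "\<exists>y. ((\<lambda>t. sin t - t / 2) has_real_derivative y) (at x) \<and> 0 \<le> y" by blast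
  qed (use that in auto)
  thus ?thesis by simp
qed

text \<open>Up to a constant factor, powers of \<open>sin t\<close> may be replaced by powers of \<open>t\<close> whatever the sign of the exponent.\<close>

lemma powr_le_two_powr_abs:
  fixes x y p :: real
  assumes "0 < y" "y / 2 \<le> x" "x \<le> y"
  shows "x powr p \<le> 2 powr \<bar>p\<bar> * y powr p"
proof (cases "0 \<le> p")
  case True
  have "x powr p \<le> y powr p" using assms True by (intro powr_mono2) auto
  also have "\<dots> \<le> 2 powr \<bar>p\<bar> * y powr p"
    using mult_right_mono[of 1 "2 powr \<bar>p\<bar>" "y powr p"] by (simp add: ge_one_powr_ge_zero)
  finally show ?thesis .
next
  case False
  have "x powr p \<le> (y / 2) powr p" using assms False by (intro powr_mono2') auto
  also have "\<dots> = 2 powr \<bar>p\<bar> * y powr p"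
    using False assms by (simp add: powr_divide powr_minus field_simps)
  finally show ?thesis .
qed

definition trig_pow :: "real \<Rightarrow> real \<Rightarrow> real \<Rightarrow> real" where
  "trig_pow p q t = sin t powr p * cos t powr q"

text \<open>The derivative of \<open>trig_pow p q\<close> is again a combination of functions of this form, which makes all
derivatives easy to bound.\<close>

definition trig_pow' :: "real \<Rightarrow> real \<Rightarrow> real \<Rightarrow> real" where
  "trig_pow' p q t = p * trig_pow (p - 1) (q + 1) t - q * trig_pow (p + 1) (q - 1) t"

definition trig_pow'' :: "real \<Rightarrow> real \<Rightarrow> real \<Rightarrow> real" where
  "trig_pow'' p q t = p * trig_pow' (p - 1) (q + 1) t - q * trig_pow' (p + 1) (q - 1) t"

lemma trig_pow_mult: "trig_pow p q t * trig_pow r s t = trig_pow (p + r) (q + s) t"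
  by (simp add: trig_pow_def powr_add)

lemma trig_pow_reflect: "trig_pow p q (pi / 2 - t) = trig_pow q p t"
  by (simp add: trig_pow_def sin_diff cos_diff)

lemma trig_pow_measurable [measurable]: "trig_pow p q \<in> borel_measurable borel"
  unfolding trig_pow_def by measurable

lemma has_real_derivative_trig_pow:
  assumes "0 < t" "t < pi / 2"
  shows "(trig_pow p q has_real_derivative trig_pow' p q t) (at t)"
proof -
  have s: "0 < sin t" "0 < cos t"
    using assms sin_gt_zero[of t] cos_gt_zero[of t] by auto
  have "((\<lambda>t. sin t powr p * cos t powr q) has_real_derivative
      (p * sin t powr (p - 1) * cos t) * cos t powr q
      + sin t powr p * (q * cos t powr (q - 1) * (- sin t))) (at t)"
    using s by (auto intro!: derivative_eq_intros simp: powr_diff field_simps)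
  moreover have "(p * sin t powr (p - 1) * cos t) * cos t powr q
      + sin t powr p * (q * cos t powr (q - 1) * (- sin t)) = trig_pow' p q t"
    using s by (simp add: trig_pow'_def trig_pow_def powr_add mult_ac)
  ultimately show ?thesis
    unfolding trig_pow_def[abs_def] by simp
qed

lemma has_real_derivative_trig_pow':
  assumes "0 < t" "t < pi / 2"
  shows "(trig_pow' p q has_real_derivative trig_pow'' p q t) (at t)"
  unfolding trig_pow'_def[of p q, abs_def] trig_pow''_def
  by (auto intro!: derivative_eq_intros has_real_derivative_trig_pow assms)

text \<open>\<open>O(t\<^sup>r)\<close> at \<open>0\<close>, but uniformly on half of the quarter period, so that the bounds can be integrated
without splitting off a compact part.\<close>

definition pow_bounded :: "(real \<Rightarrow> real) \<Rightarrow> real \<Rightarrow> bool" where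
  "pow_bounded h r \<longleftrightarrow> (\<exists>C\<ge>0. \<forall>t\<in>{0<..pi/4}. \<bar>h t\<bar> \<le> C * t powr r)"

lemma pow_boundedI:
  assumes "\<And>t. t \<in> {0<..pi/4} \<Longrightarrow> \<bar>h t\<bar> \<le> C * t powr r"
  shows "pow_bounded h r"
proof -
  have "\<bar>h t\<bar> \<le> \<bar>C\<bar> * t powr r" if "t \<in> {0<..pi/4}" for t
    using order.trans[OF assms[OF that] mult_right_mono[of C "\<bar>C\<bar>" "t powr r"]] by simp
  thus ?thesis unfolding pow_bounded_def by (intro exI[of _ "\<bar>C\<bar>"]) auto
qed

lemma quarter_pi_le_1: "pi / 4 \<le> 1"
  using pi_less_4 by simp

lemma pow_bounded_mono:
  assumes "pow_bounded h r" "r' \<le> r"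
  shows "pow_bounded h r'"
proof -
  obtain C where C: "0 \<le> C" "\<forall>t\<in>{0<..pi/4}. \<bar>h t\<bar> \<le> C * t powr r"
    using assms unfolding pow_bounded_def by blast
  show ?thesis
  proof (rule pow_boundedI[of _ C])
    fix t :: real assume t: "t \<in> {0<..pi/4}"
    have "t powr r \<le> t powr r'"
      using t quarter_pi_le_1 assms(2) by (intro powr_mono') auto
    thus "\<bar>h t\<bar> \<le> C * t powr r'"
      using C t by (meson mult_left_mono order.trans)
  qed
qed

lemma pow_bounded_add:
  assumes "pow_bounded f r" "pow_bounded g r"
  shows "pow_bounded (\<lambda>t. f t + g t) r"
proof -
  obtain C D where "\<forall>t\<in>{0<..pi/4}. \<bar>f t\<bar> \<le> C * t powr r" "\<forall>t\<in>{0<..pi/4}. \<bar>g t\<bar> \<le> D * t powr r"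
    using assms unfolding pow_bounded_def by blast
  hence "\<bar>f t + g t\<bar> \<le> (C + D) * t powr r" if "t \<in> {0<..pi/4}" for t
    using that by (intro order.trans[OF abs_triangle_ineq]) (simp add: distrib_right add_mono)
  thus ?thesis by (rule pow_boundedI)
qed

lemma pow_bounded_mult:
  assumes "pow_bounded f r" "pow_bounded g s"
  shows "pow_bounded (\<lambda>t. f t * g t) (r + s)"
proof -
  obtain C D where CD: "0 \<le> C" "\<forall>t\<in>{0<..pi/4}. \<bar>f t\<bar> \<le> C * t powr r"
      "\<forall>t\<in>{0<..pi/4}. \<bar>g t\<bar> \<le> D * t powr s"
    using assms unfolding pow_bounded_def by blast
  show ?thesis
  proof (rule pow_boundedI[of _ "C * D"])
    fix t assume "t \<in> {0<..pi/4}"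
    hence "\<bar>f t\<bar> * \<bar>g t\<bar> \<le> (C * t powr r) * (D * t powr s)"
      using CD by (intro mult_mono) auto
    thus "\<bar>f t * g t\<bar> \<le> C * D * t powr (r + s)"
      by (simp add: abs_mult powr_add mult_ac)
  qed
qed

lemma pow_bounded_const: "pow_bounded (\<lambda>_. k) 0"
  by (rule pow_boundedI[of _ "\<bar>k\<bar>"]) auto

lemma pow_bounded_cmult: "pow_bounded f r \<Longrightarrow> pow_bounded (\<lambda>t. k * f t) r"
  using pow_bounded_mult[OF pow_bounded_const] by fastforce

lemma pow_bounded_diff: "pow_bounded f r \<Longrightarrow> pow_bounded g r \<Longrightarrow> pow_bounded (\<lambda>t. f t - g t) r"
  using pow_bounded_add[of f r "\<lambda>t. (- 1) * g t"] pow_bounded_cmult[of g r "- 1"] by simp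

lemma pow_bounded_trig_pow: 
  assumes "r \<le> p"
  shows "pow_bounded (trig_pow p q) r"
proof (rule pow_bounded_mono[OF _ assms], rule pow_boundedI)
  fix t :: real assume t: "t \<in> {0<..pi/4}"
  have "sin t powr p \<le> 2 powr \<bar>p\<bar> * t powr p"
    using t half_le_sin[of t] sin_x_le_x[of t] by (intro powr_le_two_powr_abs) auto
  moreover have "cos t powr q \<le> 2 powr \<bar>q\<bar> * 1 powr q"
    using t cos_ge_half[of t] by (intro powr_le_two_powr_abs) auto
  ultimately have "sin t powr p * cos t powr q \<le> (2 powr \<bar>p\<bar> * t powr p) * (2 powr \<bar>q\<bar> * 1 powr q)"
    by (intro mult_mono) auto
  thus "\<bar>trig_pow p q t\<bar> \<le> (2 powr \<bar>p\<bar> * 2 powr \<bar>q\<bar>) * t powr p"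
    by (simp add: trig_pow_def mult_ac)
qed

lemma pow_bounded_trig_pow': "pow_bounded (trig_pow' p q) (p - 1)"
  unfolding trig_pow'_def[abs_def]
  by (intro pow_bounded_diff pow_bounded_cmult pow_bounded_trig_pow) auto

lemma pow_bounded_trig_pow'': "pow_bounded (trig_pow'' p q) (p - 2)"
  unfolding trig_pow''_def[abs_def]
  by (intro pow_bounded_diff pow_bounded_cmult pow_bounded_mono[OF pow_bounded_trig_pow']) auto

text \<open>For \<open>p = 0\<close> the term of order \<open>t powr (p - 2)\<close>, which carries a factor \<open>p\<close>, drops out:
\<open>cos\<^sup>q\<close> is smooth at \<open>0\<close>.\<close>

lemma pow_bounded_trig_pow''_0: "pow_bounded (trig_pow'' 0 q) 0"
proof -
  have "trig_pow'' 0 q = (\<lambda>t. (- q) * (1 * trig_pow 0 q t - (q - 1) * trig_pow 2 (q - 2) t))"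
    by (simp add: fun_eq_iff trig_pow''_def trig_pow'_def)
  moreover have "pow_bounded (\<lambda>t. (- q) * (1 * trig_pow 0 q t - (q - 1) * trig_pow 2 (q - 2) t)) 0"
    by (intro pow_bounded_diff pow_bounded_cmult pow_bounded_trig_pow) auto
  ultimately show ?thesis by simp
qed

text \<open>An exponent \<open>\<kappa>\<close> for which the second derivative of \<open>trig_pow p q\<close> is \<open>O(t powr (\<kappa> - 2))\<close> at \<open>0\<close>.
The cut-off \<open>1/2\<close> stands for any number in \<open>(0, 1)\<close>: a positive \<open>\<kappa>\<close> already makes the moments summable,
and the cosine integral estimate requires \<open>\<kappa> < 1\<close>.\<close>

definition pow_order :: "real \<Rightarrow> real" where
  "pow_order p = (if p = 0 then 1 / 2 else min p (1 / 2))"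

lemma pow_bounded_trig_pow''_order: "pow_bounded (trig_pow'' p q) (pow_order p - 2)"
  using pow_bounded_mono[OF pow_bounded_trig_pow''_0[of q], of "- 3 / 2"]
    pow_bounded_mono[OF pow_bounded_trig_pow''[of p q], of "min p (1 / 2) - 2"]
  by (auto simp: pow_order_def)

text \<open>\<open>- ln (cos t)\<close> is at most \<open>1 / cos t - 1\<close>, hence at most \<open>(1 / cos t)\<^sup>2 - 1 = (sin t / cos t)\<^sup>2\<close>.\<close>

lemma pow_bounded_ln_cos: "pow_bounded (\<lambda>t. ln (cos t)) 2"
proof -
  obtain C where C: "\<forall>t\<in>{0<..pi/4}. \<bar>trig_pow 2 (- 2) t\<bar> \<le> C * t powr 2"
    using pow_bounded_trig_pow[of 2 2 "- 2"] unfolding pow_bounded_def by auto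
  show ?thesis
  proof (rule pow_boundedI[of _ C])
    fix t :: real assume t: "t \<in> {0<..pi/4}"
    have c: "0 < cos t" using cos_ge_half[of t] t by auto
    have s: "0 < sin t" using half_le_sin[of t] t by auto
    have "- ln (cos t) = ln (inverse (cos t))" using c by (simp add: ln_inverse)
    also have "\<dots> \<le> inverse (cos t) - 1"
      using c by (intro ln_le_minus_one) auto
    also have "\<dots> \<le> (inverse (cos t))\<^sup>2 - 1"
      using c power_increasing[of 1 2 "inverse (cos t)"] by (simp add: one_le_inverse)
    also have "\<dots> = trig_pow 2 (- 2) t"
    proof -
      have "trig_pow 2 (- 2) t = (1 - (cos t)\<^sup>2) * inverse ((cos t)\<^sup>2)"
        using s c by (simp add: trig_pow_def powr_minus flip: sin_squared_eq)
      also have "\<dots> = (inverse (cos t))\<^sup>2 - 1"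
        using c by (simp add: left_diff_distrib power_inverse)
      finally show ?thesis by simp
    qed
    also have "\<dots> \<le> C * t powr 2" using C t by (auto dest: abs_le_D1)
    finally show "\<bar>ln (cos t)\<bar> \<le> C * t powr 2" using c by simp
  qed
qed

text \<open>The constant is explicit in \<open>\<eta>\<close> because \<open>\<eta>\<close> is later taken to be \<open>1 / ln m\<close>.\<close>

lemma abs_ln_sin_le:
  assumes t: "t \<in> {0<..pi/4}" and \<eta>: "0 < \<eta>" "\<eta> \<le> 1"
  shows "\<bar>ln (sin t)\<bar> \<le> 2 / \<eta> * t powr (- \<eta>)"
proof -
  have s: "0 < sin t" "t / 2 \<le> sin t" using half_le_sin[of t] t by auto
  have "- ln (sin t) \<le> ln (2 / t)"
    using ln_mono[of "t / 2" "sin t"] s t by (simp add: ln_div)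
  also have "\<dots> \<le> (2 / t) powr \<eta> / \<eta>"
    using t \<eta> quarter_pi_le_1 by (intro ln_powr_bound) (auto simp: field_simps)
  also have "\<dots> = 2 powr \<eta> / \<eta> * t powr (- \<eta>)"
    using t by (simp add: powr_divide powr_minus field_simps)
  also have "\<dots> \<le> 2 / \<eta> * t powr (- \<eta>)"
    using \<eta> powr_mono[of \<eta> 1 2] by (intro mult_right_mono divide_right_mono) auto
  finally show ?thesis using s by simp
qed

section \<open>Cosine integrals over a quarter period\<close>

text \<open>What the estimate of cosine integrals needs to know about \<open>h\<close> near a singular endpoint at \<open>0\<close>. The bounds
on \<open>h\<close> and \<open>h1\<close> are only used qualitatively, so their exponent is hidden; \<open>\<kappa>\<close> and \<open>B\<close> determine the rate
and the constant, and \<open>h1\<close> enters the boundary term.\<close>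

definition endpoint_bounds :: "(real \<Rightarrow> real) \<Rightarrow> (real \<Rightarrow> real) \<Rightarrow> real \<Rightarrow> real \<Rightarrow> bool" where
  "endpoint_bounds h h1 \<kappa> B \<longleftrightarrow> (\<exists>h2 D \<rho>. \<rho> > - 1 \<and> (\<forall>t\<in>{0<..pi/4}.
     (h has_real_derivative h1 t) (at t) \<and> (h1 has_real_derivative h2 t) (at t) \<and>
     \<bar>h t\<bar> \<le> D * t powr \<rho> \<and> \<bar>h1 t\<bar> \<le> D * t powr (\<rho> - 1) \<and> \<bar>h2 t\<bar> \<le> B * t powr (\<kappa> - 2)))"

lemma endpoint_bounds_nonneg:
  assumes "endpoint_bounds h h1 \<kappa> B"
  shows "0 \<le> B"
proof -
  obtain h2 where "\<bar>h2 (pi/4)\<bar> \<le> B * (pi/4) powr (\<kappa> - 2)"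
    using assms unfolding endpoint_bounds_def by (auto dest!: bspec[of _ _ "pi/4"])
  thus ?thesis by (smt (verit) mult_neg_pos powr_gt_zero pi_gt_zero divide_pos_pos)
qed

lemma endpoint_bounds_mono:
  assumes h: "endpoint_bounds h h1 \<kappa> B" and le: "\<kappa>' \<le> \<kappa>" "B \<le> B'"
  shows "endpoint_bounds h h1 \<kappa>' B'"
proof -
  have "B * t powr (\<kappa> - 2) \<le> B' * t powr (\<kappa>' - 2)" if "t \<in> {0<..pi/4}" for t
    using that le endpoint_bounds_nonneg[OF h] quarter_pi_le_1
    by (intro mult_mono powr_mono') auto
  thus ?thesis
    using h unfolding endpoint_bounds_def by (meson order.trans)
qed

lemma endpoint_bounds_absolutely_integrable:
  assumes h: "endpoint_bounds h h1 \<kappa> B" and [measurable]: "h \<in> borel_measurable borel"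
  shows "h absolutely_integrable_on {0..pi/4}"
proof -
  obtain D \<rho> where \<rho>: "\<rho> > - 1" and b: "\<And>t. t \<in> {0<..pi/4} \<Longrightarrow> \<bar>h t\<bar> \<le> D * t powr \<rho>"
    using h unfolding endpoint_bounds_def by blast
  have "h absolutely_integrable_on {0<..pi/4}"
  proof (rule measurable_bounded_by_integrable_imp_absolutely_integrable)
    show "(\<lambda>t. D * t powr \<rho>) integrable_on {0<..pi/4}"
      by (intro integrable_on_mult_right integrable_on_powr_from_0' \<rho>) auto
    show "h \<in> borel_measurable (lebesgue_on {0<..pi/4})"
      by (intro measurable_restrict_space1) (auto intro: borel_measurable_if_D measurable_completion)
  qed (use b in auto)
  thus ?thesis
    by (subst absolutely_integrable_spike_set_eq[where T = "{0<..pi/4}"])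
       (auto intro: negligible_subset[of "{0}"])
qed

lemma absolutely_integrable_on_mult_cos:
  fixes h :: "real \<Rightarrow> real"
  assumes h: "h absolutely_integrable_on S" and S: "S \<in> sets lebesgue"
  shows "(\<lambda>t. h t * cos (l * t)) absolutely_integrable_on S"
proof -
  have "(\<lambda>t. cos (l * t) * h t) absolutely_integrable_on S"
  proof (rule absolutely_integrable_bounded_measurable_product_real[OF _ S _ h])
    have "(\<lambda>t. cos (l * t)) \<in> borel_measurable borel" by measurable
    thus "(\<lambda>t. cos (l * t)) \<in> borel_measurable (lebesgue_on S)"
      by (intro measurable_restrict_space1) (auto intro: measurable_completion)
    show "bounded ((\<lambda>t. cos (l * t)) ` S)"
      by (rule boundedI[of _ 1]) auto
  qed
  thus ?thesis by (simp add: mult.commute)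
qed

text \<open>The reflection \<open>t = \<pi>/2 - u\<close> moves the other end of the quarter period to \<open>0\<close>, and multiplies
\<open>cos (2mt)\<close> by \<open>(-1)\<^sup>m\<close> because the frequency is an even integer.\<close>

lemma half_interval_reflection:
  fixes G :: "real \<Rightarrow> real" and m :: nat
  assumes G: "(\<lambda>u. G (pi / 2 - u)) absolutely_integrable_on {0..pi/4}"
  shows "G absolutely_integrable_on {pi/4..pi/2}"
    and "integral {pi/4..pi/2} (\<lambda>t. G t * cos (2 * real m * t))
         = (- 1) ^ m * integral {0..pi/4} (\<lambda>u. G (pi / 2 - u) * cos (2 * real m * u))"
proof -
  have img: "(\<lambda>u. pi / 2 - u) ` {0..pi/4} = {pi/4..pi/2}"
    by (auto simp: image_iff intro!: bexI[of _ "pi / 2 - _"])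
  have cov: "(\<lambda>u. \<bar>- 1\<bar> * F (pi / 2 - u)) absolutely_integrable_on {0..pi/4} \<and>
        integral {0..pi/4} (\<lambda>u. \<bar>- 1\<bar> * F (pi / 2 - u)) = b
     \<longleftrightarrow> F absolutely_integrable_on {pi/4..pi/2} \<and> integral {pi/4..pi/2} F = b" for F :: "real \<Rightarrow> real" and b
    unfolding img[symmetric]
    by (rule has_absolute_integral_change_of_variables_1')
       (auto intro!: derivative_eq_intros inj_onI)
  show "G absolutely_integrable_on {pi/4..pi/2}"
    using cov[of G "integral {0..pi/4} (\<lambda>u. G (pi / 2 - u))"] G by simp
  have eq: "G (pi / 2 - u) * cos (2 * real m * (pi / 2 - u))
      = (- 1) ^ m * (G (pi / 2 - u) * cos (2 * real m * u))" for u
  proof -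
    have "2 * real m * (pi / 2 - u) = real m * pi - 2 * real m * u" by (simp add: algebra_simps)
    thus ?thesis by (simp add: cos_diff cos_npi)
  qed
  have "(\<lambda>u. G (pi / 2 - u) * cos (2 * real m * (pi / 2 - u))) absolutely_integrable_on {0..pi/4}"
    unfolding eq by (intro set_integrable_mult_right absolutely_integrable_on_mult_cos G) auto
  hence "integral {pi/4..pi/2} (\<lambda>t. G t * cos (2 * real m * t))
      = integral {0..pi/4} (\<lambda>u. G (pi / 2 - u) * cos (2 * real m * (pi / 2 - u)))"
    using cov[of "\<lambda>t. G t * cos (2 * real m * t)"
        "integral {0..pi/4} (\<lambda>u. G (pi / 2 - u) * cos (2 * real m * (pi / 2 - u)))"] by simp
  thus "integral {pi/4..pi/2} (\<lambda>t. G t * cos (2 * real m * t))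
         = (- 1) ^ m * integral {0..pi/4} (\<lambda>u. G (pi / 2 - u) * cos (2 * real m * u))"
    unfolding eq by simp
qed

text \<open>Both halves of the quarter period contribute a boundary term of order \<open>1/m\<close> at \<open>\<pi>/4\<close>. These two cancel:
their sum has the factor \<open>(1 + (-1)\<^sup>m) sin (m\<pi>/2)\<close>, which is zero for even and for odd \<open>m\<close>. What remains at
\<open>\<pi>/4\<close> is of order \<open>1/m\<^sup>2\<close> and does not depend on \<open>\<kappa>\<close> and \<open>B\<close>.\<close>

lemma cosine_integral_bound:
  fixes G :: "real \<Rightarrow> real" and m :: nat
  assumes G0: "endpoint_bounds G G1 \<kappa> B"
    and G1: "endpoint_bounds (\<lambda>u. G (pi / 2 - u)) G2 \<kappa> B"
    and [measurable]: "G \<in> borel_measurable borel"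
    and \<kappa>: "- 1 < \<kappa>" "\<kappa> < 1" and m: "m \<ge> 1"
  shows "\<bar>integral {0..pi/2} (\<lambda>t. G t * cos (2 * real m * t))\<bar>
    \<le> (2 * B * (1 / (1 + \<kappa>) + 2 / (1 - \<kappa>)) + \<bar>G1 (pi/4)\<bar> + \<bar>G2 (pi/4)\<bar>) * real m powr (- 1 - \<kappa>)"
proof -
  define l where "l = 2 * real m"
  define X where "X g = G (pi/4) * sin (l * (pi/4)) / l - g * (1 - cos (l * (pi/4))) / l\<^sup>2" for g
  define E where "E = B * (1 / (1 + \<kappa>) + 2 / (1 - \<kappa>)) * l powr (- 1 - \<kappa>)"
  define I1 I2 where "I1 = integral {0..pi/4} (\<lambda>t. G t * cos (l * t))"
    and "I2 = integral {0..pi/4} (\<lambda>u. G (pi / 2 - u) * cos (l * u))"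
  define \<sigma> :: real where "\<sigma> = (- 1) ^ m"
  have l: "l > 0" "1 / l \<le> pi / 4"
    using m pi_gt3 by (auto simp: l_def field_simps intro: order.trans[of _ "pi * 1"] mult_left_mono)
  have est: "\<bar>integral {0..pi/4} (\<lambda>t. h t * cos (l * t)) - (h (pi/4) * sin (l * (pi/4)) / l
      - h1 (pi/4) * (1 - cos (l * (pi/4))) / l\<^sup>2)\<bar> \<le> E"
    if hb: "endpoint_bounds h h1 \<kappa> B" and [measurable]: "h \<in> borel_measurable borel" for h h1
  proof -
    obtain h2 D \<rho> where "\<rho> > - 1" and b: "\<forall>t\<in>{0<..pi/4}.
       (h has_real_derivative h1 t) (at t) \<and> (h1 has_real_derivative h2 t) (at t) \<and>
       \<bar>h t\<bar> \<le> D * t powr \<rho> \<and> \<bar>h1 t\<bar> \<le> D * t powr (\<rho> - 1) \<and> \<bar>h2 t\<bar> \<le> B * t powr (\<kappa> - 2)"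
      using hb unfolding endpoint_bounds_def by blast
    moreover have "(\<lambda>t. h t * cos (l * t)) integrable_on {0..pi/4}"
      using absolutely_integrable_on_mult_cos[OF endpoint_bounds_absolutely_integrable[OF hb]]
      by (auto simp: absolutely_integrable_on_def)
    ultimately show ?thesis
      unfolding E_def by (intro endpoint_cos_integral_estimate[OF _ l(2,1) _ \<kappa>, of \<rho> h h1 h2 D]) auto
  qed
  have e1: "\<bar>I1 - X (G1 (pi/4))\<bar> \<le> E"
    using est[OF G0] unfolding I1_def X_def by simp
  have e2: "\<bar>I2 - X (G2 (pi/4))\<bar> \<le> E"
    using est[OF G1] unfolding I2_def X_def by simp
  have int1: "G absolutely_integrable_on {0..pi/4}"
    by (rule endpoint_bounds_absolutely_integrable[OF G0]) measurable
  have intr: "(\<lambda>u. G (pi / 2 - u)) absolutely_integrable_on {0..pi/4}"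
    by (rule endpoint_bounds_absolutely_integrable[OF G1]) measurable
  have int2: "G absolutely_integrable_on {pi/4..pi/2}"
    by (rule half_interval_reflection(1)[OF intr])
  have un: "{0..pi/4} \<union> {pi/4..pi/2} = {0..pi/2}" by auto
  have "G absolutely_integrable_on {0..pi/2}"
    using set_integrable_Un[OF int1 int2] unfolding un by simp
  hence "(\<lambda>t. G t * cos (l * t)) integrable_on {0..pi/2}"
    using absolutely_integrable_on_mult_cos[of "{0..pi/2}" G] by (auto simp: absolutely_integrable_on_def)
  hence "integral {0..pi/2} (\<lambda>t. G t * cos (l * t))
      = I1 + integral {pi/4..pi/2} (\<lambda>t. G t * cos (l * t))"
    unfolding I1_def by (intro Henstock_Kurzweil_Integration.integral_combine[symmetric]) auto
  also have "integral {pi/4..pi/2} (\<lambda>t. G t * cos (l * t)) = \<sigma> * I2"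
    unfolding l_def I2_def \<sigma>_def by (rule half_interval_reflection(2)[OF intr])
  finally have I: "integral {0..pi/2} (\<lambda>t. G t * cos (l * t)) = I1 + \<sigma> * I2" .
  have \<sigma>: "\<bar>\<sigma>\<bar> = 1" by (simp add: \<sigma>_def power_abs)
  have sin0: "(1 + \<sigma>) * sin (l * (pi/4)) = 0"
  proof (cases "even m")
    case True
    then obtain k where "m = 2 * k" by (rule evenE)
    hence "l * (pi/4) = real k * pi" by (simp add: l_def)
    thus ?thesis by (simp add: sin_npi)
  qed (simp add: \<sigma>_def)
  have "X (G1 (pi/4)) + \<sigma> * X (G2 (pi/4)) =
      G (pi/4) * ((1 + \<sigma>) * sin (l * (pi/4))) / l
      - (G1 (pi/4) + \<sigma> * G2 (pi/4)) * ((1 - cos (l * (pi/4))) / l\<^sup>2)"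
    using l by (simp add: X_def field_simps)
  hence X: "X (G1 (pi/4)) + \<sigma> * X (G2 (pi/4)) =
      - (G1 (pi/4) + \<sigma> * G2 (pi/4)) * ((1 - cos (l * (pi/4))) / l\<^sup>2)"
    unfolding sin0 mult_zero_right div_0 diff_0 mult_minus_left .
  have "\<bar>X (G1 (pi/4)) + \<sigma> * X (G2 (pi/4))\<bar> \<le> (\<bar>G1 (pi/4)\<bar> + \<bar>G2 (pi/4)\<bar>) * (1 / (real m)\<^sup>2)"
    unfolding X abs_mult
  proof (rule mult_mono)
    show "\<bar>- (G1 (pi/4) + \<sigma> * G2 (pi/4))\<bar> \<le> \<bar>G1 (pi/4)\<bar> + \<bar>G2 (pi/4)\<bar>"
      using abs_triangle_ineq[of "G1 (pi/4)" "\<sigma> * G2 (pi/4)"] \<sigma> by (simp add: abs_mult)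
    have "0 \<le> 1 - cos (l * (pi/4))" "1 - cos (l * (pi/4)) \<le> 4"
      using cos_ge_minus_one[of "l * (pi/4)"] cos_le_one[of "l * (pi/4)"] by linarith+
    hence "\<bar>(1 - cos (l * (pi/4))) / l\<^sup>2\<bar> \<le> 4 / l\<^sup>2"
      by (simp add: divide_right_mono)
    thus "\<bar>(1 - cos (l * (pi/4))) / l\<^sup>2\<bar> \<le> 1 / (real m)\<^sup>2"
      by (simp add: l_def power_mult_distrib)
  qed auto
  also have "\<dots> \<le> (\<bar>G1 (pi/4)\<bar> + \<bar>G2 (pi/4)\<bar>) * real m powr (- 1 - \<kappa>)"
  proof (intro mult_left_mono)
    have "1 / (real m)\<^sup>2 = real m powr (- 2)" using m by (simp add: powr_minus field_simps)
    also have "\<dots> \<le> real m powr (- 1 - \<kappa>)" using m \<kappa> by (intro powr_mono) auto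
    finally show "1 / (real m)\<^sup>2 \<le> real m powr (- 1 - \<kappa>)" .
  qed auto
  finally have Xb: "\<bar>X (G1 (pi/4)) + \<sigma> * X (G2 (pi/4))\<bar>
      \<le> (\<bar>G1 (pi/4)\<bar> + \<bar>G2 (pi/4)\<bar>) * real m powr (- 1 - \<kappa>)" .
  have B: "0 \<le> B" by (rule endpoint_bounds_nonneg[OF G0])
  have Em: "E \<le> B * (1 / (1 + \<kappa>) + 2 / (1 - \<kappa>)) * real m powr (- 1 - \<kappa>)"
    unfolding E_def l_def using m \<kappa> B by (intro mult_left_mono powr_mono2') auto
  have "I1 + \<sigma> * I2 = (I1 - X (G1 (pi/4))) + \<sigma> * (I2 - X (G2 (pi/4)))
      + (X (G1 (pi/4)) + \<sigma> * X (G2 (pi/4)))"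
    by (simp add: algebra_simps)
  hence "\<bar>I1 + \<sigma> * I2\<bar> \<le> \<bar>I1 - X (G1 (pi/4))\<bar> + \<bar>\<sigma> * (I2 - X (G2 (pi/4)))\<bar>
      + \<bar>X (G1 (pi/4)) + \<sigma> * X (G2 (pi/4))\<bar>"
    by linarith
  also have "\<bar>\<sigma> * (I2 - X (G2 (pi/4)))\<bar> = \<bar>I2 - X (G2 (pi/4))\<bar>"
    by (simp add: abs_mult \<sigma>)
  finally have "\<bar>I1 + \<sigma> * I2\<bar> \<le> 2 * (B * (1 / (1 + \<kappa>) + 2 / (1 - \<kappa>)) * real m powr (- 1 - \<kappa>))
      + (\<bar>G1 (pi/4)\<bar> + \<bar>G2 (pi/4)\<bar>) * real m powr (- 1 - \<kappa>)"
    using e1 e2 Em Xb by linarith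
  thus ?thesis
    unfolding I[symmetric] by (simp add: l_def algebra_simps)
qed

lemma endpoint_bounds_imp_absolutely_integrable:
  fixes G :: "real \<Rightarrow> real"
  assumes G0: "endpoint_bounds G G1 \<kappa> B"
    and G1: "endpoint_bounds (\<lambda>u. G (pi / 2 - u)) G2 \<kappa>' B'"
    and [measurable]: "G \<in> borel_measurable borel"
  shows "G absolutely_integrable_on {0..pi/2}"
proof -
  have un: "{0..pi/4} \<union> {pi/4..pi/2} = {0..pi/2}" by auto
  show ?thesis
    using set_integrable_Un[OF endpoint_bounds_absolutely_integrable[OF G0]
        half_interval_reflection(1)[OF endpoint_bounds_absolutely_integrable[OF G1]]]
    unfolding un by simp
qed

section \<open>Endpoint behaviour of the transformed weights\<close>

lemma endpoint_bounds_trig_pow: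
  assumes p: "p > - 1"
  shows "\<exists>B. endpoint_bounds (trig_pow p q) (trig_pow' p q) (pow_order p) B"
proof -
  obtain C where C: "\<forall>t\<in>{0<..pi/4}. \<bar>trig_pow p q t\<bar> \<le> C * t powr p"
    using pow_bounded_trig_pow[of p p q] unfolding pow_bounded_def by auto
  obtain C' where C': "\<forall>t\<in>{0<..pi/4}. \<bar>trig_pow' p q t\<bar> \<le> C' * t powr (p - 1)"
    using pow_bounded_trig_pow'[of p q] unfolding pow_bounded_def by auto
  obtain B where B: "\<forall>t\<in>{0<..pi/4}. \<bar>trig_pow'' p q t\<bar> \<le> B * t powr (pow_order p - 2)"
    using pow_bounded_trig_pow''_order[of p q] unfolding pow_bounded_def by auto
  have "endpoint_bounds (trig_pow p q) (trig_pow' p q) (pow_order p) B"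
    unfolding endpoint_bounds_def
  proof (rule exI[of _ "trig_pow'' p q"], rule exI[of _ "max C C'"], rule exI[of _ p], intro conjI ballI p)
    fix t :: real assume t: "t \<in> {0<..pi/4}"
    show "(trig_pow p q has_real_derivative trig_pow' p q t) (at t)"
      "(trig_pow' p q has_real_derivative trig_pow'' p q t) (at t)"
      using t pi_gt_zero
      by (auto intro!: has_real_derivative_trig_pow has_real_derivative_trig_pow')
    show "\<bar>trig_pow p q t\<bar> \<le> max C C' * t powr p"
      by (rule order.trans[OF bspec[OF C t]]) (auto intro: mult_right_mono)
    show "\<bar>trig_pow' p q t\<bar> \<le> max C C' * t powr (p - 1)"
      by (rule order.trans[OF bspec[OF C' t]]) (auto intro: mult_right_mono)
    show "\<bar>trig_pow'' p q t\<bar> \<le> B * t powr (pow_order p - 2)"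
      by (rule bspec[OF B t])
  qed
  thus ?thesis by blast
qed

lemma DERIV_ln_cos: "((\<lambda>t. ln (cos t)) has_real_derivative - trig_pow 1 (- 1) t) (at t)"
  if "0 < t" "t < pi / 2" for t
  using that cos_gt_zero[of t] sin_gt_zero[of t]
  by (auto intro!: derivative_eq_intros simp: trig_pow_def powr_minus field_simps)

lemma DERIV_ln_sin: "((\<lambda>t. ln (sin t)) has_real_derivative trig_pow (- 1) 1 t) (at t)"
  if "0 < t" "t < pi / 2" for t
  using that cos_gt_zero[of t] sin_gt_zero[of t]
  by (auto intro!: derivative_eq_intros simp: trig_pow_def powr_minus field_simps)

definition log_cos_pow' :: "real \<Rightarrow> real \<Rightarrow> real \<Rightarrow> real" where
  "log_cos_pow' p q t = trig_pow' p q t * ln (cos t) - trig_pow (p + 1) (q - 1) t"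

definition log_sin_pow' :: "real \<Rightarrow> real \<Rightarrow> real \<Rightarrow> real" where
  "log_sin_pow' p q t = trig_pow' p q t * ln (sin t) + trig_pow (p - 1) (q + 1) t"

text \<open>The double zero of \<open>ln cos\<close> at \<open>0\<close> raises the order of every derivative by two. The
second derivative is thus \<open>O(t\<^sup>p)\<close>, which is better than \<open>t powr (1/2 - 2)\<close> for all \<open>p > -1\<close>.\<close>

lemma endpoint_bounds_log_cos:
  assumes p: "p > - 1"
  shows "\<exists>B. endpoint_bounds (\<lambda>t. trig_pow p q t * ln (cos t)) (log_cos_pow' p q) (1 / 2) B"
proof -
  define h2 where "h2 t = trig_pow'' p q t * ln (cos t) - trig_pow' p q t * trig_pow 1 (- 1) t
      - trig_pow' (p + 1) (q - 1) t" for t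
  have "pow_bounded (\<lambda>t. trig_pow p q t * ln (cos t)) p"
    by (rule pow_bounded_mono[OF pow_bounded_mult[OF pow_bounded_trig_pow[OF order_refl] pow_bounded_ln_cos]]) auto
  then obtain C where C: "\<forall>t\<in>{0<..pi/4}. \<bar>trig_pow p q t * ln (cos t)\<bar> \<le> C * t powr p"
    unfolding pow_bounded_def by auto
  have "pow_bounded (log_cos_pow' p q) (p - 1)"
    unfolding log_cos_pow'_def[abs_def]
    by (intro pow_bounded_diff pow_bounded_mono[OF pow_bounded_mult[OF pow_bounded_trig_pow' pow_bounded_ln_cos]]
        pow_bounded_trig_pow) auto
  then obtain C' where C': "\<forall>t\<in>{0<..pi/4}. \<bar>log_cos_pow' p q t\<bar> \<le> C' * t powr (p - 1)"
    unfolding pow_bounded_def by auto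
  have "pow_bounded h2 p"
    unfolding h2_def[abs_def]
  proof (intro pow_bounded_diff)
    show "pow_bounded (\<lambda>t. trig_pow'' p q t * ln (cos t)) p"
      using pow_bounded_mult[OF pow_bounded_trig_pow'' pow_bounded_ln_cos] by force
    show "pow_bounded (\<lambda>t. trig_pow' p q t * trig_pow 1 (- 1) t) p"
      using pow_bounded_mult[OF pow_bounded_trig_pow' pow_bounded_trig_pow[of 1 1 "- 1"]] by force
    show "pow_bounded (trig_pow' (p + 1) (q - 1)) p"
      using pow_bounded_trig_pow'[of "p + 1"] by simp
  qed
  hence "pow_bounded h2 (1 / 2 - 2)"
    by (rule pow_bounded_mono) (use p in linarith)
  then obtain B where B: "\<forall>t\<in>{0<..pi/4}. \<bar>h2 t\<bar> \<le> B * t powr (1 / 2 - 2)"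
    unfolding pow_bounded_def by auto
  have "endpoint_bounds (\<lambda>t. trig_pow p q t * ln (cos t)) (log_cos_pow' p q) (1 / 2) B"
    unfolding endpoint_bounds_def
  proof (rule exI[of _ h2], rule exI[of _ "max C C'"], rule exI[of _ p], intro conjI ballI p)
    fix t :: real assume t: "t \<in> {0<..pi/4}"
    hence t': "0 < t" "t < pi / 2" using pi_gt_zero by auto
    note der = has_real_derivative_trig_pow[OF t'] has_real_derivative_trig_pow'[OF t'] DERIV_ln_cos[OF t']
    show "((\<lambda>t. trig_pow p q t * ln (cos t)) has_real_derivative log_cos_pow' p q t) (at t)"
      using DERIV_mult[OF der(1)[of p q] der(3)]
      by (simp add: log_cos_pow'_def trig_pow_mult add.commute mult.commute)
    show "(log_cos_pow' p q has_real_derivative h2 t) (at t)"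
      unfolding log_cos_pow'_def[abs_def] h2_def
      by (rule DERIV_cong[OF DERIV_diff[OF DERIV_mult[OF der(2)[of p q] der(3)] der(1)[of "p + 1" "q - 1"]]])
         (simp add: algebra_simps)
    show "\<bar>trig_pow p q t * ln (cos t)\<bar> \<le> max C C' * t powr p"
      by (rule order.trans[OF bspec[OF C t]]) (auto intro: mult_right_mono)
    show "\<bar>log_cos_pow' p q t\<bar> \<le> max C C' * t powr (p - 1)"
      by (rule order.trans[OF bspec[OF C' t]]) (auto intro: mult_right_mono)
    show "\<bar>h2 t\<bar> \<le> B * t powr (1 / 2 - 2)"
      by (rule bspec[OF B t])
  qed
  thus ?thesis by blast
qed

text \<open>In the second derivative, the logarithm survives only as a factor of \<open>trig_pow''\<close>. It costs an arbitrarily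
small power \<open>\<eta>\<close>, at the price of a factor \<open>1/\<eta>\<close>. For \<open>p = 0\<close> that factor \<open>trig_pow''\<close> is bounded, so that the
terms of order \<open>t powr -2\<close> without logarithm dominate and nothing is lost.\<close>

lemma endpoint_bounds_log_sin:
  assumes p: "p > - 1"
  shows "\<exists>B0. \<forall>\<eta> \<kappa>. 0 < \<eta> \<and> \<eta> \<le> 1 \<and> \<kappa> \<le> p \<and> (p = 0 \<and> \<eta> = 1 \<or> \<kappa> \<le> p - \<eta>) \<longrightarrow>
     endpoint_bounds (\<lambda>t. trig_pow p q t * ln (sin t)) (log_sin_pow' p q) \<kappa> (B0 / \<eta>)"
proof -
  define r where "r t = trig_pow' p q t * trig_pow (- 1) 1 t + trig_pow' (p - 1) (q + 1) t" for t
  define h2 where "h2 t = trig_pow'' p q t * ln (sin t) + r t" for t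
  \<comment> \<open>Any loss that leaves the exponent above \<open>-1\<close> serves for the qualitative bounds on the function and its first derivative.\<close>
  define \<epsilon> where "\<epsilon> = min 1 ((p + 1) / 2)"
  have \<epsilon>: "0 < \<epsilon>" "\<epsilon> \<le> 1" "- 1 < p - \<epsilon>" using p by (auto simp: \<epsilon>_def min_def field_simps)
  have ln: "pow_bounded (\<lambda>t. ln (sin t)) (- \<epsilon>)"
    by (rule pow_boundedI) (rule abs_ln_sin_le[OF _ \<epsilon>(1,2)])
  have "pow_bounded (\<lambda>t. trig_pow p q t * ln (sin t)) (p - \<epsilon>)"
    using pow_bounded_mult[OF pow_bounded_trig_pow[OF order_refl] ln] by simp
  then obtain C where C: "\<forall>t\<in>{0<..pi/4}. \<bar>trig_pow p q t * ln (sin t)\<bar> \<le> C * t powr (p - \<epsilon>)"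
    unfolding pow_bounded_def by auto
  have "pow_bounded (log_sin_pow' p q) (p - \<epsilon> - 1)"
    unfolding log_sin_pow'_def[abs_def]
    by (intro pow_bounded_add pow_bounded_mono[OF pow_bounded_mult[OF pow_bounded_trig_pow' ln]]
        pow_bounded_trig_pow) (use \<epsilon> in auto)
  then obtain C' where C': "\<forall>t\<in>{0<..pi/4}. \<bar>log_sin_pow' p q t\<bar> \<le> C' * t powr (p - \<epsilon> - 1)"
    unfolding pow_bounded_def by auto
  have "pow_bounded r (p - 2)"
    unfolding r_def[abs_def]
  proof (intro pow_bounded_add)
    show "pow_bounded (\<lambda>t. trig_pow' p q t * trig_pow (- 1) 1 t) (p - 2)"
      using pow_bounded_mult[OF pow_bounded_trig_pow' pow_bounded_trig_pow[of "- 1" "- 1" 1]] by force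
    show "pow_bounded (trig_pow' (p - 1) (q + 1)) (p - 2)"
      using pow_bounded_trig_pow'[of "p - 1"] by simp
  qed
  then obtain R where R: "0 \<le> R" "\<forall>t\<in>{0<..pi/4}. \<bar>r t\<bar> \<le> R * t powr (p - 2)"
    unfolding pow_bounded_def by auto
  \<comment> \<open>The order of \<open>trig_pow''\<close>, which for \<open>p = 0\<close> is better by two than in general.\<close>
  define e where "e = (if p = 0 then 0 else p - 2)"
  have "pow_bounded (trig_pow'' p q) e"
    using pow_bounded_trig_pow''_0[of q] pow_bounded_trig_pow''[of p q] by (auto simp: e_def)
  then obtain K where K: "0 \<le> K" "\<forall>t\<in>{0<..pi/4}. \<bar>trig_pow'' p q t\<bar> \<le> K * t powr e"
    unfolding pow_bounded_def by auto
  have "endpoint_bounds (\<lambda>t. trig_pow p q t * ln (sin t)) (log_sin_pow' p q) \<kappa> ((2 * K + R) / \<eta>)"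
    if \<eta>: "0 < \<eta>" "\<eta> \<le> 1" and \<kappa>: "\<kappa> \<le> p" "p = 0 \<and> \<eta> = 1 \<or> \<kappa> \<le> p - \<eta>" for \<eta> \<kappa>
    unfolding endpoint_bounds_def
  proof (rule exI[of _ h2], rule exI[of _ "max C C'"], rule exI[of _ "p - \<epsilon>"], intro conjI ballI \<epsilon>(3))
    fix t :: real assume t: "t \<in> {0<..pi/4}"
    hence t': "0 < t" "t < pi / 2" using pi_gt_zero by auto
    have t1: "t \<le> 1" using t quarter_pi_le_1 by auto
    note der = has_real_derivative_trig_pow[OF t'] has_real_derivative_trig_pow'[OF t'] DERIV_ln_sin[OF t']
    show "((\<lambda>t. trig_pow p q t * ln (sin t)) has_real_derivative log_sin_pow' p q t) (at t)"
      using DERIV_mult[OF der(1)[of p q] der(3)]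
      by (simp add: log_sin_pow'_def trig_pow_mult add.commute mult.commute)
    show "(log_sin_pow' p q has_real_derivative h2 t) (at t)"
      unfolding log_sin_pow'_def[abs_def] h2_def r_def
      by (rule DERIV_cong[OF DERIV_add[OF DERIV_mult[OF der(2)[of p q] der(3)] der(1)[of "p - 1" "q + 1"]]])
         (simp add: algebra_simps)
    show "\<bar>trig_pow p q t * ln (sin t)\<bar> \<le> max C C' * t powr (p - \<epsilon>)"
      by (rule order.trans[OF bspec[OF C t]]) (auto intro: mult_right_mono)
    show "\<bar>log_sin_pow' p q t\<bar> \<le> max C C' * t powr (p - \<epsilon> - 1)"
      by (rule order.trans[OF bspec[OF C' t]]) (auto intro: mult_right_mono)
    have "\<bar>trig_pow'' p q t\<bar> * \<bar>ln (sin t)\<bar> \<le> (K * t powr e) * (2 / \<eta> * t powr (- \<eta>))"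
      using K t by (intro mult_mono abs_ln_sin_le \<eta>) auto
    also have "\<dots> = 2 * K / \<eta> * t powr (e - \<eta>)"
      by (simp add: powr_diff powr_minus field_simps)
    also have "\<dots> \<le> 2 * K / \<eta> * t powr (\<kappa> - 2)"
      using K \<eta> \<kappa> t' t1 by (intro mult_left_mono powr_mono') (auto simp: e_def)
    finally have 1: "\<bar>trig_pow'' p q t * ln (sin t)\<bar> \<le> 2 * K / \<eta> * t powr (\<kappa> - 2)"
      by (simp add: abs_mult)
    have "\<bar>r t\<bar> \<le> R * t powr (p - 2)" using R t by auto
    also have "\<dots> \<le> R / \<eta> * t powr (\<kappa> - 2)"
      using R \<eta> \<kappa> t' t1 by (intro mult_mono powr_mono') (auto simp: field_simps mult_left_le)
    finally show "\<bar>h2 t\<bar> \<le> (2 * K + R) / \<eta> * t powr (\<kappa> - 2)"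
      unfolding h2_def using 1 
      by (intro order.trans[OF abs_triangle_ineq]) (simp add: add_divide_distrib distrib_right)
  qed
  thus ?thesis by blast
qed

section \<open>Chebyshev moments of the weights\<close>

definition moment :: "(real \<Rightarrow> real) \<Rightarrow> nat \<Rightarrow> real" where
  "moment w m = (LINT x:{-1..1}|lborel. w x * cheb_T m x)"

lemma cheb_T_cos: "cheb_T m (cos \<theta>) = cos (real m * \<theta>)" if "\<theta> \<in> {0..pi}"
  using that by (simp add: cheb_T_def arccos_cos)

lemma continuous_on_cheb_T: "continuous_on {-1..1} (cheb_T m)"
  unfolding cheb_T_def by (intro continuous_intros continuous_on_arccos') auto

lemma set_integrable_mult_continuous:
  fixes w g :: "real \<Rightarrow> real"
  assumes w: "set_integrable lborel {-1..1} w" and g: "continuous_on {-1..1} g"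
  shows "set_integrable lborel {-1..1} (\<lambda>x. w x * g x)"
proof -
  obtain C where C: "\<And>x. x \<in> {-1..1} \<Longrightarrow> \<bar>g x\<bar> \<le> C"
    using compact_imp_bounded[OF compact_continuous_image[OF g compact_Icc]]
    unfolding bounded_iff by (auto simp del: atLeastAtMost_iff)
  show ?thesis
    unfolding set_integrable_def
  proof (rule Bochner_Integration.integrable_bound)
    show "integrable lborel (\<lambda>x. C * (indicator {-1..1} x *\<^sub>R w x))"
      using w unfolding set_integrable_def by simp
    have "(\<lambda>x. (indicator {-1..1} x *\<^sub>R w x) * (indicator {-1..1} x *\<^sub>R g x)) \<in> borel_measurable lborel"
      using w borel_measurable_continuous_on_indicator[OF _ g] unfolding set_integrable_def
      by (intro borel_measurable_times) auto
    moreover have "(\<lambda>x. (indicator {-1..1} x *\<^sub>R w x) * (indicator {-1..1} x *\<^sub>R g x))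
        = (\<lambda>x. indicator {-1..1} x *\<^sub>R (w x * g x))"
      by (auto simp: indicator_def)
    ultimately show "(\<lambda>x. indicator {-1..1} x *\<^sub>R (w x * g x)) \<in> borel_measurable lborel" by simp
    have "norm (indicator {-1..1} x *\<^sub>R (w x * g x)) \<le> norm (C * (indicator {-1..1} x *\<^sub>R w x))" for x
    proof (cases "x \<in> {-1..1}")
      case True
      hence "\<bar>w x\<bar> * \<bar>g x\<bar> \<le> \<bar>w x\<bar> * \<bar>C\<bar>" using C[OF True] by (intro mult_left_mono) auto
      thus ?thesis using True by (simp add: abs_mult mult.commute)
    qed simp
    thus "AE x in lborel. norm (indicator {-1..1} x *\<^sub>R (w x * g x))
        \<le> norm (C * (indicator {-1..1} x *\<^sub>R w x))" by simp
  qed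
qed

text \<open>The change of variables also transfers integrability from \<open>G\<close>, whose endpoint bounds are known, to \<open>w\<close>.
The constant \<open>K\<close> is kept apart from \<open>G\<close> so that \<open>G\<close> can be a plain product of powers.\<close>

lemma moment_substitution:
  fixes w G :: "real \<Rightarrow> real"
  assumes [measurable]: "w \<in> borel_measurable borel"
    and wG: "\<And>t. t \<in> {0..pi/2} \<Longrightarrow> 2 * sin (2 * t) * w (cos (2 * t)) = K * G t"
    and G: "G absolutely_integrable_on {0..pi/2}"
  shows "set_integrable lborel {-1..1} w"
    and "moment w m = K * integral {0..pi/2} (\<lambda>t. G t * cos (2 * real m * t))"
proof -
  have img: "(\<lambda>t. cos (2 * t)) ` {0..pi/2} = {-1..1}"
  proof -
    have "(\<lambda>t. cos (2 * t)) ` {0..pi/2} = cos ` ((*) 2 ` {0..pi/2})"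
      by (simp only: image_image)
    also have "(*) 2 ` {0..pi/2} = {0..pi}" by (simp add: image_mult_atLeastAtMost)
    also have "cos ` {0..pi} = {-1..1}"
    proof -
      have "x \<in> cos ` {0..pi}" if "x \<in> {-1..1}" for x
        using that by (intro image_eqI[of _ _ "arccos x"]) (auto intro: arccos_lbound arccos_ubound)
      thus ?thesis by auto
    qed
    finally show ?thesis .
  qed
  have inj: "inj_on (\<lambda>t. cos (2 * t)) {0..pi/2}"
  proof (rule inj_onI)
    fix s t :: real assume "s \<in> {0..pi/2}" "t \<in> {0..pi/2}" "cos (2 * s) = cos (2 * t)"
    thus "s = t" using cos_inj_pi[of "2 * s" "2 * t"] by auto
  qed
  have cov: "(\<lambda>t. \<bar>- 2 * sin (2 * t)\<bar> * F (cos (2 * t))) absolutely_integrable_on {0..pi/2} \<and>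
        integral {0..pi/2} (\<lambda>t. \<bar>- 2 * sin (2 * t)\<bar> * F (cos (2 * t))) = b
     \<longleftrightarrow> F absolutely_integrable_on {-1..1} \<and> integral {-1..1} F = b" for F :: "real \<Rightarrow> real" and b
    unfolding img[symmetric]
    by (rule has_absolute_integral_change_of_variables_1'[OF _ _ inj])
       (auto intro!: derivative_eq_intros)
  have sinpos: "\<bar>- 2 * sin (2 * t)\<bar> = 2 * sin (2 * t)" if "t \<in> {0..pi/2}" for t
    using that sin_ge_zero[of "2 * t"] by simp
  have "(\<lambda>t. \<bar>- 2 * sin (2 * t)\<bar> * w (cos (2 * t))) absolutely_integrable_on {0..pi/2}
      \<longleftrightarrow> (\<lambda>t. K * G t) absolutely_integrable_on {0..pi/2}"
    by (rule set_integrable_cong) (use sinpos wG in auto)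
  hence "w absolutely_integrable_on {-1..1}"
    using cov[of w] set_integrable_mult_right[of K, OF G] by auto
  thus w: "set_integrable lborel {-1..1} w"
    unfolding set_integrable_def by (subst (asm) integrable_completion) auto
  have eq: "\<bar>- 2 * sin (2 * t)\<bar> * (w (cos (2 * t)) * cheb_T m (cos (2 * t))) = K * (G t * cos (2 * real m * t))"
    if t: "t \<in> {0..pi/2}" for t
  proof -
    have "cheb_T m (cos (2 * t)) = cos (2 * real m * t)"
      using cheb_T_cos[of "2 * t" m] t by (simp add: mult_ac)
    thus ?thesis using wG[OF t] sinpos[OF t] by (metis mult.assoc)
  qed
  have "(\<lambda>t. K * (G t * cos (2 * real m * t))) absolutely_integrable_on {0..pi/2}"
    by (intro set_integrable_mult_right absolutely_integrable_on_mult_cos G) auto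
  hence "(\<lambda>t. \<bar>- 2 * sin (2 * t)\<bar> * (w (cos (2 * t)) * cheb_T m (cos (2 * t)))) absolutely_integrable_on {0..pi/2}"
    by (subst set_integrable_cong[OF refl refl eq]) auto
  moreover have "integral {0..pi/2} (\<lambda>t. \<bar>- 2 * sin (2 * t)\<bar> * (w (cos (2 * t)) * cheb_T m (cos (2 * t))))
      = K * integral {0..pi/2} (\<lambda>t. G t * cos (2 * real m * t))"
    by (subst Henstock_Kurzweil_Integration.integral_cong[OF eq]) auto
  ultimately have "integral {-1..1} (\<lambda>x. w x * cheb_T m x) = K * integral {0..pi/2} (\<lambda>t. G t * cos (2 * real m * t))"
    using cov[of "\<lambda>x. w x * cheb_T m x" "K * integral {0..pi/2} (\<lambda>t. G t * cos (2 * real m * t))"] by blast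
  thus "moment w m = K * integral {0..pi/2} (\<lambda>t. G t * cos (2 * real m * t))"
    unfolding moment_def using set_borel_integral_eq_integral(2)[OF set_integrable_mult_continuous[OF w continuous_on_cheb_T]] by simp
qed

text \<open>\<open>1 - x = 2 sin\<^sup>2 t\<close> and \<open>1 + x = 2 cos\<^sup>2 t\<close>; the Jacobian \<open>2 sin (2t) = 4 sin t cos t\<close> adds one to each exponent.
The identity also holds at the ends, where both sides are \<open>0\<close>.\<close>

lemma jacobi_weight_cos:
  assumes t: "t \<in> {0..pi/2}"
  shows "2 * sin (2 * t) * jacobi_weight \<alpha> \<beta> (cos (2 * t))
       = 4 * 2 powr (\<alpha> + \<beta>) * trig_pow (2 * \<alpha> + 1) (2 * \<beta> + 1) t"
proof -
  have s: "0 \<le> sin t" "0 \<le> cos t"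
    using t sin_ge_zero[of t] cos_ge_zero[of t] by auto
  have P: "x * (2 * x\<^sup>2) powr a = 2 powr a * x powr (2 * a + 1)" if "0 \<le> x" for x a :: real
  proof (cases "x = 0")
    case False
    hence "x > 0" using that by simp
    hence "x\<^sup>2 = x powr 2" by simp
    hence "(2 * x\<^sup>2) powr a = 2 powr a * (x powr 2) powr a" by (simp only: powr_mult)
    hence "(2 * x\<^sup>2) powr a = 2 powr a * x powr (2 * a)" by (simp only: powr_powr)
    thus ?thesis using \<open>x > 0\<close> by (simp add: powr_add)
  qed simp
  have "1 - cos (2 * t) = 2 * (sin t)\<^sup>2" "1 + cos (2 * t) = 2 * (cos t)\<^sup>2"
    by (simp_all add: cos_double_sin cos_squared_eq)
  hence "2 * sin (2 * t) * jacobi_weight \<alpha> \<beta> (cos (2 * t))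
      = 4 * (sin t * (2 * (sin t)\<^sup>2) powr \<alpha>) * (cos t * (2 * (cos t)\<^sup>2) powr \<beta>)"
    by (simp add: jacobi_weight_def sin_double)
  also have "\<dots> = 4 * 2 powr (\<alpha> + \<beta>) * trig_pow (2 * \<alpha> + 1) (2 * \<beta> + 1) t"
    unfolding P[OF s(1)] P[OF s(2)] by (simp add: trig_pow_def powr_add)
  finally show ?thesis .
qed

lemma log_jacobi_weight_cos:
  assumes t: "t \<in> {0..pi/2}"
  shows "2 * sin (2 * t) * log_jacobi_weight \<alpha> \<beta> (cos (2 * t))
       = 8 * 2 powr (\<alpha> + \<beta>) * (trig_pow (2 * \<alpha> + 1) (2 * \<beta> + 1) t * ln (cos t))"
proof -
  have "ln ((cos (2 * t) + 1) / 2) = ln ((cos t)\<^sup>2)"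
    by (simp add: cos_double_cos)
  also have "\<dots> = 2 * ln (cos t)"
    using cos_ge_zero[of t] t by (cases "cos t = 0") (auto simp: ln_realpow)
  finally have "log_jacobi_weight \<alpha> \<beta> (cos (2 * t)) = 2 * ln (cos t) * jacobi_weight \<alpha> \<beta> (cos (2 * t))"
    by (simp add: log_jacobi_weight_def jacobi_weight_def)
  thus ?thesis using jacobi_weight_cos[OF t, of \<alpha> \<beta>] by (simp add: mult_ac)
qed

lemma jacobi_weight_measurable [measurable]: "jacobi_weight \<alpha> \<beta> \<in> borel_measurable borel"
  unfolding jacobi_weight_def by measurable

lemma log_jacobi_weight_measurable [measurable]: "log_jacobi_weight \<alpha> \<beta> \<in> borel_measurable borel"
  unfolding log_jacobi_weight_def by measurable

lemma
  assumes \<alpha>\<beta>: "\<alpha> > - 1" "\<beta> > - 1"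
  shows set_integrable_jacobi_weight: "set_integrable lborel {-1..1} (jacobi_weight \<alpha> \<beta>)"
    and jacobi_moment_bound: "\<exists>C. \<forall>m\<ge>1. \<bar>moment (jacobi_weight \<alpha> \<beta>) m\<bar>
      \<le> C * real m powr (- 1 - min (pow_order (2 * \<alpha> + 1)) (pow_order (2 * \<beta> + 1)))"
proof -
  define a b where "a = 2 * \<alpha> + 1" and "b = 2 * \<beta> + 1"
  have ab: "a > - 1" "b > - 1" using \<alpha>\<beta> by (auto simp: a_def b_def)
  define \<kappa> where "\<kappa> = min (pow_order a) (pow_order b)"
  have \<kappa>: "- 1 < \<kappa>" "\<kappa> < 1" using ab by (auto simp: \<kappa>_def pow_order_def)
  obtain B1 B2 where "endpoint_bounds (trig_pow a b) (trig_pow' a b) (pow_order a) B1"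
      "endpoint_bounds (trig_pow b a) (trig_pow' b a) (pow_order b) B2"
    using endpoint_bounds_trig_pow[OF ab(1)] endpoint_bounds_trig_pow[OF ab(2)] by blast
  hence e: "endpoint_bounds (trig_pow a b) (trig_pow' a b) \<kappa> (max B1 B2)"
      "endpoint_bounds (\<lambda>u. trig_pow a b (pi / 2 - u)) (trig_pow' b a) \<kappa> (max B1 B2)"
    unfolding trig_pow_reflect by (auto elim!: endpoint_bounds_mono simp: \<kappa>_def)
  note int = endpoint_bounds_imp_absolutely_integrable[OF e trig_pow_measurable]
  show "set_integrable lborel {-1..1} (jacobi_weight \<alpha> \<beta>)"
    by (rule moment_substitution(1)[OF jacobi_weight_measurable _ int])
       (unfold a_def b_def, rule jacobi_weight_cos)
  have sub: "moment (jacobi_weight \<alpha> \<beta>) m = 4 * 2 powr (\<alpha> + \<beta>)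
      * integral {0..pi/2} (\<lambda>t. trig_pow a b t * cos (2 * real m * t))" for m
    by (rule moment_substitution(2)[OF jacobi_weight_measurable _ int])
       (unfold a_def b_def, rule jacobi_weight_cos)
  define C where "C = 2 * max B1 B2 * (1 / (1 + \<kappa>) + 2 / (1 - \<kappa>)) + \<bar>trig_pow' a b (pi/4)\<bar> + \<bar>trig_pow' b a (pi/4)\<bar>"
  have "\<bar>moment (jacobi_weight \<alpha> \<beta>) m\<bar> \<le> 4 * 2 powr (\<alpha> + \<beta>) * C * real m powr (- 1 - \<kappa>)" if "m \<ge> 1" for m
  proof -
    have "\<bar>integral {0..pi/2} (\<lambda>t. trig_pow a b t * cos (2 * real m * t))\<bar> \<le> C * real m powr (- 1 - \<kappa>)"
      unfolding C_def by (rule cosine_integral_bound[OF e trig_pow_measurable \<kappa> that])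
    from mult_left_mono[OF this, of "4 * 2 powr (\<alpha> + \<beta>)"] show ?thesis
      unfolding sub by (simp add: abs_mult mult.assoc)
  qed
  thus "\<exists>C. \<forall>m\<ge>1. \<bar>moment (jacobi_weight \<alpha> \<beta>) m\<bar>
      \<le> C * real m powr (- 1 - min (pow_order (2 * \<alpha> + 1)) (pow_order (2 * \<beta> + 1)))"
    unfolding \<kappa>_def a_def b_def by blast
qed

text \<open>
\<open>C\<close> depends neither on \<open>\<eta>\<close> nor on \<open>\<kappa>\<close>, so that both may be chosen as functions of \<open>m\<close>. The admissible \<open>\<kappa>\<close>
is governed by the exponent \<open>2\<beta> + 1\<close> at \<open>x = -1\<close> alone: at \<open>x = 1\<close> the zero of the logarithm
leaves a bound with \<open>\<kappa> = 1/2\<close>.\<close>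

lemma
  assumes \<alpha>\<beta>: "\<alpha> > - 1" "\<beta> > - 1"
  shows set_integrable_log_jacobi_weight: "set_integrable lborel {-1..1} (log_jacobi_weight \<alpha> \<beta>)"
    and log_jacobi_moment_bound: "\<exists>C\<ge>0. \<forall>\<eta> \<kappa>. \<forall>m\<ge>1.
      0 < \<eta> \<and> \<eta> \<le> 1 \<and> - 1 < \<kappa> \<and> \<kappa> \<le> 1 / 2 \<and> \<kappa> \<le> 2 * \<beta> + 1 \<and>
      (2 * \<beta> + 1 = 0 \<and> \<eta> = 1 \<or> \<kappa> \<le> 2 * \<beta> + 1 - \<eta>) \<longrightarrow>
      \<bar>moment (log_jacobi_weight \<alpha> \<beta>) m\<bar> \<le> C / (\<eta> * (1 + \<kappa>)) * real m powr (- 1 - \<kappa>)"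
proof -
  define a b where "a = 2 * \<alpha> + 1" and "b = 2 * \<beta> + 1"
  have ab: "a > - 1" "b > - 1" using \<alpha>\<beta> by (auto simp: a_def b_def)
  define G where "G t = trig_pow a b t * ln (cos t)" for t
  have refl: "G (pi / 2 - u) = trig_pow b a u * ln (sin u)" for u
    unfolding G_def trig_pow_reflect by (simp add: cos_diff)
  have [measurable]: "G \<in> borel_measurable borel" unfolding G_def by measurable
  obtain B1 where B1: "endpoint_bounds G (log_cos_pow' a b) (1 / 2) B1"
    using endpoint_bounds_log_cos[OF ab(1)] unfolding G_def by blast
  obtain B0 where B0: "\<And>\<eta> \<kappa>. 0 < \<eta> \<Longrightarrow> \<eta> \<le> 1 \<Longrightarrow> \<kappa> \<le> b \<Longrightarrow> b = 0 \<and> \<eta> = 1 \<or> \<kappa> \<le> b - \<eta> \<Longrightarrow>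
     endpoint_bounds (\<lambda>u. G (pi / 2 - u)) (log_sin_pow' b a) \<kappa> (B0 / \<eta>)"
    using endpoint_bounds_log_sin[OF ab(2), of a] unfolding refl by blast
  have B1n: "0 \<le> B1" by (rule endpoint_bounds_nonneg[OF B1])
  have B0n: "0 \<le> B0" using endpoint_bounds_nonneg[OF B0[of 1 "b - 1"]] by simp
  have "endpoint_bounds (\<lambda>u. G (pi / 2 - u)) (log_sin_pow' b a) (b - 1) (B0 / 1)"
    by (rule B0) auto
  hence int: "G absolutely_integrable_on {0..pi/2}"
    by (rule endpoint_bounds_imp_absolutely_integrable[OF B1]) measurable
  define K where "K = 8 * 2 powr (\<alpha> + \<beta>)"
  show "set_integrable lborel {-1..1} (log_jacobi_weight \<alpha> \<beta>)"
    by (rule moment_substitution(1)[OF log_jacobi_weight_measurable _ int])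
       (unfold G_def a_def b_def, rule log_jacobi_weight_cos)
  have sub: "moment (log_jacobi_weight \<alpha> \<beta>) m = K * integral {0..pi/2} (\<lambda>t. G t * cos (2 * real m * t))" for m
    by (rule moment_substitution(2)[OF log_jacobi_weight_measurable _ int])
       (unfold G_def K_def a_def b_def, rule log_jacobi_weight_cos)
  define H where "H = \<bar>log_cos_pow' a b (pi/4)\<bar> + \<bar>log_sin_pow' b a (pi/4)\<bar>"
  have "\<bar>moment (log_jacobi_weight \<alpha> \<beta>) m\<bar>
      \<le> K * (14 * (B1 + B0) + 2 * H) / (\<eta> * (1 + \<kappa>)) * real m powr (- 1 - \<kappa>)"
    if \<eta>: "0 < \<eta>" "\<eta> \<le> 1" and \<kappa>: "- 1 < \<kappa>" "\<kappa> \<le> 1 / 2" "\<kappa> \<le> b" "b = 0 \<and> \<eta> = 1 \<or> \<kappa> \<le> b - \<eta>"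
      and m: "m \<ge> 1" for \<eta> \<kappa> m
  proof -
    define B where "B = (B1 + B0) / \<eta>"
    have "B1 \<le> B1 / \<eta>" using B1n \<eta> by (simp add: field_simps mult_left_le)
    moreover have "0 \<le> B0 / \<eta>" using B0n \<eta> by simp
    ultimately have "B1 \<le> B" "B0 / \<eta> \<le> B" using B1n \<eta> by (auto simp: B_def add_divide_distrib)
    hence e: "endpoint_bounds G (log_cos_pow' a b) \<kappa> B"
        "endpoint_bounds (\<lambda>u. G (pi / 2 - u)) (log_sin_pow' b a) \<kappa> B"
      using endpoint_bounds_mono[OF B1] endpoint_bounds_mono[OF B0[OF \<eta> \<kappa>(3,4)]] \<kappa> by auto
    have 1: "\<bar>integral {0..pi/2} (\<lambda>t. G t * cos (2 * real m * t))\<bar>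
       \<le> (2 * B * (1 / (1 + \<kappa>) + 2 / (1 - \<kappa>)) + H) * real m powr (- 1 - \<kappa>)"
      using cosine_integral_bound[OF e _ \<kappa>(1) _ m] \<kappa> unfolding H_def by (simp add: add.assoc)
    \<comment> \<open>Since \<open>\<kappa> \<le> 1/2\<close>, only the singularity of the constant at \<open>\<kappa> = -1\<close> matters.\<close>
    have "2 / (1 - \<kappa>) \<le> 6 / (1 + \<kappa>)" using \<kappa> by (simp add: field_simps)
    hence "1 / (1 + \<kappa>) + 2 / (1 - \<kappa>) \<le> 7 / (1 + \<kappa>)" by (simp add: add_divide_distrib[symmetric] field_simps)
    hence "2 * B * (1 / (1 + \<kappa>) + 2 / (1 - \<kappa>)) \<le> 2 * B * (7 / (1 + \<kappa>))"
      using endpoint_bounds_nonneg[OF e(1)] by (intro mult_left_mono) auto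
    also have "\<dots> = 14 * (B1 + B0) / (\<eta> * (1 + \<kappa>))" by (simp add: B_def)
    finally have 2: "2 * B * (1 / (1 + \<kappa>) + 2 / (1 - \<kappa>)) \<le> 14 * (B1 + B0) / (\<eta> * (1 + \<kappa>))" .
    have "\<eta> * (1 + \<kappa>) \<le> 1 * 2" using \<eta> \<kappa> by (intro mult_mono) auto
    hence "H * (\<eta> * (1 + \<kappa>)) \<le> H * 2" by (intro mult_left_mono) (auto simp: H_def)
    hence 3: "H \<le> 2 * H / (\<eta> * (1 + \<kappa>))" using \<eta> \<kappa> by (simp add: pos_le_divide_eq)
    have "(2 * B * (1 / (1 + \<kappa>) + 2 / (1 - \<kappa>)) + H) * real m powr (- 1 - \<kappa>)
      \<le> ((14 * (B1 + B0) + 2 * H) / (\<eta> * (1 + \<kappa>))) * real m powr (- 1 - \<kappa>)"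
      using 2 3 by (intro mult_right_mono) (auto simp: add_divide_distrib)
    from mult_left_mono[OF order.trans[OF 1 this], of K]
    have "K * \<bar>integral {0..pi/2} (\<lambda>t. G t * cos (2 * real m * t))\<bar> \<le>
        K * (((14 * (B1 + B0) + 2 * H) / (\<eta> * (1 + \<kappa>))) * real m powr (- 1 - \<kappa>))"
      by (simp add: K_def)
    moreover have "\<bar>moment (log_jacobi_weight \<alpha> \<beta>) m\<bar> = K * \<bar>integral {0..pi/2} (\<lambda>t. G t * cos (2 * real m * t))\<bar>"
      unfolding sub by (simp add: abs_mult K_def)
    ultimately show ?thesis by (simp add: mult_ac)
  qed
  moreover have "0 \<le> K * (14 * (B1 + B0) + 2 * H)" using B1n B0n by (simp add: K_def H_def)
  ultimately show "\<exists>C\<ge>0. \<forall>\<eta> \<kappa>. \<forall>m\<ge>1.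
      0 < \<eta> \<and> \<eta> \<le> 1 \<and> - 1 < \<kappa> \<and> \<kappa> \<le> 1 / 2 \<and> \<kappa> \<le> 2 * \<beta> + 1 \<and>
      (2 * \<beta> + 1 = 0 \<and> \<eta> = 1 \<or> \<kappa> \<le> 2 * \<beta> + 1 - \<eta>) \<longrightarrow>
      \<bar>moment (log_jacobi_weight \<alpha> \<beta>) m\<bar> \<le> C / (\<eta> * (1 + \<kappa>)) * real m powr (- 1 - \<kappa>)"
    unfolding b_def by (intro exI[of _ "K * (14 * (B1 + B0) + 2 * H)"]) blast
qed

section \<open>Interpolatory rules applied to Chebyshev polynomials\<close>

lemma set_lebesgue_integral_weighted_sum:
  fixes w :: "real \<Rightarrow> real" and h :: "'a \<Rightarrow> real \<Rightarrow> real"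
  assumes w: "set_integrable lborel {-1..1} w" and fin: "finite A"
    and h: "\<And>y. y \<in> A \<Longrightarrow> continuous_on {-1..1} (h y)"
  shows "(LINT x:{-1..1}|lborel. w x * (\<Sum>y\<in>A. c y * h y x))
       = (\<Sum>y\<in>A. c y * (LINT x:{-1..1}|lborel. w x * h y x))"
  using fin h
proof (induction A rule: finite_induct)
  case empty
  show ?case by simp
next
  case (insert y A)
  have i1: "set_integrable lborel {-1..1} (\<lambda>x. w x * (c y * h y x))"
    by (intro set_integrable_mult_continuous[OF w] continuous_intros insert.prems) auto
  have i2: "set_integrable lborel {-1..1} (\<lambda>x. w x * (\<Sum>z\<in>A. c z * h z x))"
    by (intro set_integrable_mult_continuous[OF w] continuous_intros insert.prems) auto
  have "(LINT x:{-1..1}|lborel. w x * (\<Sum>z\<in>insert y A. c z * h z x))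
      = (LINT x:{-1..1}|lborel. w x * (c y * h y x) + w x * (\<Sum>z\<in>A. c z * h z x))"
    using insert.hyps by (simp add: distrib_left)
  also have "\<dots> = (LINT x:{-1..1}|lborel. w x * (c y * h y x))
      + (LINT x:{-1..1}|lborel. w x * (\<Sum>z\<in>A. c z * h z x))"
    by (rule set_integral_add(2)[OF i1 i2])
  also have "(LINT x:{-1..1}|lborel. w x * (c y * h y x)) = c y * (LINT x:{-1..1}|lborel. w x * h y x)"
    unfolding mult.left_commute[of _ "c y"] by (rule set_integral_mult_right)
  also have "(LINT x:{-1..1}|lborel. w x * (\<Sum>z\<in>A. c z * h z x))
      = (\<Sum>z\<in>A. c z * (LINT x:{-1..1}|lborel. w x * h z x))"
    using insert.prems by (intro insert.IH) auto
  finally show ?case using insert.hyps by simp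
qed

fun cheb_poly :: "nat \<Rightarrow> real poly" where
  "cheb_poly 0 = 1"
| "cheb_poly (Suc 0) = [:0, 1:]"
| "cheb_poly (Suc (Suc n)) = [:0, 2:] * cheb_poly (Suc n) - cheb_poly n"

lemma degree_cheb_poly: "degree (cheb_poly m) \<le> m"
proof (induction m rule: cheb_poly.induct)
  case (3 n)
  have "degree ([:0, 2:] * cheb_poly (Suc n)) \<le> Suc (Suc n)"
    using degree_mult_le[of "[:0, 2:]" "cheb_poly (Suc n)"] 3 by simp
  thus ?case using 3 by (simp add: degree_diff_le del: mult_pCons_left)
qed auto

lemma poly_cheb_poly_cos: "poly (cheb_poly m) (cos \<theta>) = cos (real m * \<theta>)"
proof (induction m rule: cheb_poly.induct)
  case (3 n)
  have "cos (real (Suc (Suc n)) * \<theta>) + cos (real n * \<theta>) = 2 * cos \<theta> * cos (real (Suc n) * \<theta>)"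
    using cos_plus_cos[of "real (Suc (Suc n)) * \<theta>" "real n * \<theta>"]
    by (simp add: algebra_simps add_divide_distrib diff_divide_distrib)
  thus ?case using 3 by simp
qed auto

lemma poly_cheb_poly: "poly (cheb_poly m) x = cheb_T m x" if "x \<in> {-1..1}"
  using poly_cheb_poly_cos[of m "arccos x"] that by (simp add: cheb_T_def)

lemma interp_rule_eqI:
  assumes "card (nodes n) = n" "n \<ge> 1" "degree p \<le> n - 1" "\<And>x. x \<in> nodes n \<Longrightarrow> poly p x = g x"
  shows "interp_rule nodes w n g = (LINT x:{-1..1}|lborel. w x * poly p x)"
proof -
  have "interp_poly n (nodes n) g = p"
    unfolding interp_poly_def using interp_poly_ex1[OF assms(1,2)] assms(3,4)
    by (intro the1_equality) auto
  thus ?thesis by (simp add: interp_rule_def)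
qed

text \<open>A function that agrees on the nodes with a combination of \<open>T\<^sub>m\<close>, \<open>m < n\<close>, is interpolated by that
combination, so the rule evaluates it through the moments.\<close>

lemma interp_rule_cheb_combination:
  assumes n: "card (nodes n) = n" "n \<ge> 1" and X: "nodes n \<subseteq> {-1..1}"
    and w: "set_integrable lborel {-1..1} w"
    and g: "\<And>x. x \<in> nodes n \<Longrightarrow> g x = (\<Sum>m<n. r m * cheb_T m x)"
  shows "interp_rule nodes w n g = (\<Sum>m<n. r m * moment w m)"
proof -
  define p where "p = (\<Sum>m<n. smult (r m) (cheb_poly m))"
  have deg: "degree p \<le> n - 1"
    unfolding p_def
  proof (rule degree_sum_le)
    fix m assume "m \<in> {..<n}"
    thus "degree (smult (r m) (cheb_poly m)) \<le> n - 1"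
      using degree_smult_le[of "r m" "cheb_poly m"] degree_cheb_poly[of m] by auto
  qed simp
  have p: "poly p x = (\<Sum>m<n. r m * cheb_T m x)" if "x \<in> {-1..1}" for x
    using poly_cheb_poly[OF that] by (simp add: p_def poly_sum)
  have "interp_rule nodes w n g = (LINT x:{-1..1}|lborel. w x * poly p x)"
    using p g X by (intro interp_rule_eqI n deg) auto
  also have "\<dots> = (LINT x:{-1..1}|lborel. w x * (\<Sum>m<n. r m * cheb_T m x))"
    by (intro set_lebesgue_integral_cong) (auto simp: p)
  also have "\<dots> = (\<Sum>m<n. r m * moment w m)"
    unfolding moment_def
    by (rule set_lebesgue_integral_weighted_sum[OF w]) (auto intro: continuous_on_cheb_T)
  finally show ?thesis .
qed

lemma interp_rule_cheb_exact:
  assumes "card (nodes n) = n" "m < n" "nodes n \<subseteq> {-1..1}" "set_integrable lborel {-1..1} w"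
  shows "interp_rule nodes w n (cheb_T m) = moment w m"
proof -
  have "interp_rule nodes w n (cheb_T m) = (\<Sum>i<n. (if i = m then 1 else 0) * moment w i)"
    using assms by (intro interp_rule_cheb_combination) (auto simp: if_distrib[of "\<lambda>x. x * _"] cong: if_cong)
  also have "\<dots> = moment w m" using assms(2) by (simp add: if_distrib[of "\<lambda>x. x * _"] cong: if_cong)
  finally show ?thesis .
qed

text \<open>Lagrange form of the rule. It shows linearity, and that the rule for fixed \<open>n\<close> is continuous under pointwise limits.\<close>

lemma interp_rule_weighted_sum:
  assumes n: "card (nodes n) = n" "n \<ge> 1" and w: "set_integrable lborel {-1..1} w"
  shows "\<exists>c. \<forall>g. interp_rule nodes w n g = (\<Sum>x\<in>nodes n. c x * g x)"
proof -
  have fin: "finite (nodes n)" using n card_ge_0_finite[of "nodes n"] by simp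
  define L where "L y = interp_poly n (nodes n) (\<lambda>x. if x = y then 1 else 0)" for y
  have L: "degree (L y) \<le> n - 1" "x \<in> nodes n \<Longrightarrow> poly (L y) x = (if x = y then 1 else 0)" for x y
    using theI'[OF interp_poly_ex1[OF n, of "\<lambda>x. if x = y then 1 else 0"]]
    unfolding L_def interp_poly_def by auto
  have "interp_rule nodes w n g = (\<Sum>y\<in>nodes n. (LINT x:{-1..1}|lborel. w x * poly (L y) x) * g y)" for g
  proof -
    define p where "p = (\<Sum>y\<in>nodes n. smult (g y) (L y))"
    have "interp_rule nodes w n g = (LINT x:{-1..1}|lborel. w x * poly p x)"
    proof (rule interp_rule_eqI[where nodes = nodes and n = n, OF n])
      show "degree p \<le> n - 1"
        unfolding p_def using L(1) fin degree_smult_le order.trans by (intro degree_sum_le) blast+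
      show "poly p x = g x" if "x \<in> nodes n" for x
        using that fin L(2)[OF that] by (simp add: p_def poly_sum if_distrib[of "\<lambda>z. _ * z"] cong: if_cong)
    qed
    also have "\<dots> = (LINT x:{-1..1}|lborel. w x * (\<Sum>y\<in>nodes n. g y * poly (L y) x))"
      by (simp add: p_def poly_sum)
    also have "\<dots> = (\<Sum>y\<in>nodes n. g y * (LINT x:{-1..1}|lborel. w x * poly (L y) x))"
      by (rule set_lebesgue_integral_weighted_sum[OF w fin]) (intro continuous_intros)
    finally show ?thesis by (simp add: mult.commute)
  qed
  thus ?thesis by (intro exI[of _ "\<lambda>y. LINT x:{-1..1}|lborel. w x * poly (L y) x"]) blast
qed

section \<open>Aliasing\<close>

text \<open>If \<open>2N\<theta>\<close> is a multiple of \<open>\<pi>\<close> of the same parity at all nodes \<open>cos \<theta>\<close>, adding \<open>2N\<theta>\<close> to \<open>j\<theta>\<close>, or subtracting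
\<open>j\<theta>\<close> from it, changes \<open>cos (j\<theta>)\<close> by the common sign only.\<close>

lemma interp_rule_cheb_periodic:
  assumes n: "card (nodes n) = n" "n \<ge> 1" and w: "set_integrable lborel {-1..1} w"
    and X: "\<And>x. x \<in> nodes n \<Longrightarrow> \<exists>\<theta>\<in>{0..pi}. x = cos \<theta> \<and> sin (2 * real N * \<theta>) = 0 \<and> cos (2 * real N * \<theta>) = \<sigma>"
    and \<sigma>: "\<bar>\<sigma>\<bar> = 1"
  shows "\<bar>interp_rule nodes w n (cheb_T (j + 2 * N))\<bar> = \<bar>interp_rule nodes w n (cheb_T j)\<bar>"
    and "j \<le> 2 * N \<Longrightarrow> \<bar>interp_rule nodes w n (cheb_T (2 * N - j))\<bar> = \<bar>interp_rule nodes w n (cheb_T j)\<bar>"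
proof -
  obtain c where c: "\<And>g. interp_rule nodes w n g = (\<Sum>x\<in>nodes n. c x * g x)"
    using interp_rule_weighted_sum[where nodes = nodes and n = n, OF n w] by blast
  have scale: "\<bar>interp_rule nodes w n g\<bar> = \<bar>interp_rule nodes w n h\<bar>"
    if "\<And>x. x \<in> nodes n \<Longrightarrow> g x = \<sigma> * h x" for g h
  proof -
    have "interp_rule nodes w n g = \<sigma> * interp_rule nodes w n h"
      unfolding c sum_distrib_left using that by (intro sum.cong) auto
    thus ?thesis using \<sigma> by (simp add: abs_mult)
  qed
  show "\<bar>interp_rule nodes w n (cheb_T (j + 2 * N))\<bar> = \<bar>interp_rule nodes w n (cheb_T j)\<bar>"
  proof (rule scale)
    fix x assume "x \<in> nodes n"
    then obtain \<theta> where \<theta>: "\<theta> \<in> {0..pi}" "x = cos \<theta>" "sin (2 * real N * \<theta>) = 0" "cos (2 * real N * \<theta>) = \<sigma>"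
      using X by blast
    have "cos (real (j + 2 * N) * \<theta>) = cos (real j * \<theta> + 2 * real N * \<theta>)" by (simp add: algebra_simps)
    thus "cheb_T (j + 2 * N) x = \<sigma> * cheb_T j x"
      unfolding \<theta>(2) cheb_T_cos[OF \<theta>(1)] by (simp add: cos_add \<theta>(3,4))
  qed
  show "\<bar>interp_rule nodes w n (cheb_T (2 * N - j))\<bar> = \<bar>interp_rule nodes w n (cheb_T j)\<bar>" if j: "j \<le> 2 * N"
  proof (rule scale)
    fix x assume "x \<in> nodes n"
    then obtain \<theta> where \<theta>: "\<theta> \<in> {0..pi}" "x = cos \<theta>" "sin (2 * real N * \<theta>) = 0" "cos (2 * real N * \<theta>) = \<sigma>"
      using X by blast
    have "cos (real (2 * N - j) * \<theta>) = cos (2 * real N * \<theta> - real j * \<theta>)" using j by (simp add: algebra_simps of_nat_diff)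
    thus "cheb_T (2 * N - j) x = \<sigma> * cheb_T j x"
      unfolding \<theta>(2) cheb_T_cos[OF \<theta>(1)] by (simp add: cos_diff \<theta>(3,4))
  qed
qed

lemma sum_reflected_le:
  fixes B :: "nat \<Rightarrow> real"
  assumes B: "\<And>j. 0 \<le> B j" and refl: "\<And>j. j \<le> 2 * N \<Longrightarrow> B (2 * N - j) = B j"
  shows "(\<Sum>j<2 * N. B j) \<le> 2 * (\<Sum>m\<le>N. B m)"
proof -
  have "(\<Sum>j<2 * N. B j) \<le> (\<Sum>j\<in>{..N} \<union> {N<..<2 * N}. B j)"
    by (intro sum_mono2 B) auto
  also have "\<dots> = (\<Sum>j\<le>N. B j) + (\<Sum>j\<in>{N<..<2 * N}. B j)"
    by (intro sum.union_disjoint) auto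
  also have "(\<Sum>j\<in>{N<..<2 * N}. B j) = (\<Sum>j\<in>{0<..<N}. B j)"
    by (rule sum.reindex_bij_witness[of _ "\<lambda>j. 2 * N - j" "\<lambda>j. 2 * N - j"]) (auto simp: refl)
  also have "\<dots> \<le> (\<Sum>j\<le>N. B j)"
    by (intro sum_mono2 B) auto
  finally show ?thesis by simp
qed

text \<open>The sum is half of the second-kind Chebyshev polynomial \<open>U\<^sub>m\<close> at \<open>cos \<theta>\<close>: the identity
\<open>U\<^sub>m = 2 T\<^sub>m + U\<^sub>m\<^sub>-\<^sub>2\<close> expands it in cosines of the same parity, with coefficients in \<open>[0, 1]\<close>.\<close>

lemma sin_multiple_as_cos_sum:
  "\<exists>d. (\<forall>i. 0 \<le> d i \<and> d i \<le> (1::real)) \<and>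
     (\<forall>\<theta>. 2 * sin \<theta> * (\<Sum>i\<le>m. d i * cos (real i * \<theta>)) = sin (real (m + 1) * \<theta>))"
proof (induction m rule: nat_induct2)
  case 0
  show ?case by (intro exI[of _ "\<lambda>_. 1 / 2"]) simp
next
  case 1
  show ?case
    by (intro exI[of _ "\<lambda>i. if i = 1 then 1 else 0"]) (simp add: sin_double)
next
  case (step m)
  then obtain d where d: "\<And>i. 0 \<le> d i \<and> d i \<le> (1::real)"
    "\<And>\<theta>. 2 * sin \<theta> * (\<Sum>i\<le>m. d i * cos (real i * \<theta>)) = sin (real (m + 1) * \<theta>)" by blast
  define d' where "d' i = (if i = m + 2 then 1 else if i \<le> m then d i else 0)" for i
  have "2 * sin \<theta> * (\<Sum>i\<le>m + 2. d' i * cos (real i * \<theta>)) = sin (real (m + 2 + 1) * \<theta>)" for \<theta>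
  proof -
    have "(\<Sum>i\<le>m + 2. d' i * cos (real i * \<theta>)) = (\<Sum>i\<le>m. d i * cos (real i * \<theta>)) + cos (real (m + 2) * \<theta>)"
    proof -
      have "(\<Sum>i\<le>m. d' i * cos (real i * \<theta>)) = (\<Sum>i\<le>m. d i * cos (real i * \<theta>))"
        by (intro sum.cong) (auto simp: d'_def)
      thus ?thesis by (simp add: d'_def)
    qed
    hence "2 * sin \<theta> * (\<Sum>i\<le>m + 2. d' i * cos (real i * \<theta>))
        = sin (real (m + 1) * \<theta>) + 2 * sin \<theta> * cos (real (m + 2) * \<theta>)"
      using d(2)[of \<theta>] by (simp add: distrib_left)
    also have "\<dots> = sin (real (m + 2 + 1) * \<theta>)"
    proof -
      have "sin (real (m + 2 + 1) * \<theta>) = sin (real (m + 2) * \<theta> + \<theta>)"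
        "sin (real (m + 1) * \<theta>) = sin (real (m + 2) * \<theta> - \<theta>)"
        by (simp_all add: algebra_simps)
      thus ?thesis by (simp only: sin_add sin_diff) simp
    qed
    finally show ?thesis .
  qed
  moreover have "0 \<le> d' i \<and> d' i \<le> 1" for i using d(1) by (simp add: d'_def)
  ultimately show ?case by blast
qed

lemma nodes_subset:
  "clenshaw_curtis_nodes n \<subseteq> {-1..1}" "fejer1_nodes n \<subseteq> {-1..1}" "fejer2_nodes n \<subseteq> {-1..1}"
  by (auto simp: clenshaw_curtis_nodes_def fejer1_nodes_def fejer2_nodes_def)

lemma rule_is_interp_rule:
  assumes "I \<in> {clenshaw_curtis, fejer1, fejer2}"
  shows "\<exists>nodes. I = interp_rule nodes \<and> (\<forall>n\<ge>2. card (nodes n) = n) \<and> (\<forall>n. nodes n \<subseteq> {-1..1})"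
  using assms card_clenshaw_curtis_nodes card_fejer1_nodes card_fejer2_nodes nodes_subset
  unfolding clenshaw_curtis_def fejer1_def fejer2_def by blast

lemma interp_rule_aliasing_of_base:
  assumes n: "card (nodes n) = n" "n \<ge> 1" and w: "set_integrable lborel {-1..1} w"
    and X: "\<And>x. x \<in> nodes n \<Longrightarrow> \<exists>\<theta>\<in>{0..pi}. x = cos \<theta> \<and> sin (2 * real N * \<theta>) = 0 \<and> cos (2 * real N * \<theta>) = \<sigma>"
    and \<sigma>: "\<bar>\<sigma>\<bar> = 1" and base: "(\<Sum>m\<le>N. \<bar>interp_rule nodes w n (cheb_T m)\<bar>) \<le> 4 * S"
  shows "(\<forall>j. \<bar>interp_rule nodes w n (cheb_T (j + 2 * N))\<bar> = \<bar>interp_rule nodes w n (cheb_T j)\<bar>) \<and>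
    (\<Sum>j<2 * N. \<bar>interp_rule nodes w n (cheb_T j)\<bar>) \<le> 8 * S"
  using interp_rule_cheb_periodic[where nodes = nodes and n = n, OF n w X \<sigma>] base
    sum_reflected_le[of "\<lambda>j. \<bar>interp_rule nodes w n (cheb_T j)\<bar>" N]
  by (auto intro: order.trans)

text \<open>The one index \<open>m \<le> N = n\<close> that exactness does not cover is \<open>n\<close> itself, and \<open>T\<^sub>n\<close> vanishes on the nodes.\<close>

lemma fejer1_aliasing:
  assumes n: "n \<ge> 2" and w: "set_integrable lborel {-1..1} w"
  shows "(\<forall>j. \<bar>fejer1 w n (cheb_T (j + 2 * n))\<bar> = \<bar>fejer1 w n (cheb_T j)\<bar>) \<and>
    (\<Sum>j<2 * n. \<bar>fejer1 w n (cheb_T j)\<bar>) \<le> 8 * (\<Sum>m<n. \<bar>moment w m\<bar>)"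
  unfolding fejer1_def
proof (rule interp_rule_aliasing_of_base[where nodes = fejer1_nodes and n = n, OF card_fejer1_nodes _ w, where \<sigma> = "- 1"])
  have angle: "\<exists>\<theta>\<in>{0..pi}. x = cos \<theta> \<and> sin (2 * real n * \<theta>) = 0 \<and> cos (2 * real n * \<theta>) = - 1 \<and> cos (real n * \<theta>) = 0"
    if x: "x \<in> fejer1_nodes n" for x
  proof -
    obtain j where j: "j \<in> {1..n}" "x = cos ((2 * real j - 1) * pi / (2 * real n))"
      using x unfolding fejer1_nodes_def by blast
    define \<theta> where "\<theta> = (2 * real j - 1) * pi / (2 * real n)"
    have e: "real n * \<theta> = real j * pi - pi / 2" "2 * real n * \<theta> = real (2 * j) * pi - pi"
      using n by (simp_all add: \<theta>_def field_simps)
    have "(2 * real j - 1) * pi \<le> (2 * real n) * pi"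
      using j by (intro mult_right_mono) auto
    hence "\<theta> \<in> {0..pi}" using j n by (simp add: \<theta>_def divide_le_eq mult.commute)
    moreover have "sin (2 * real n * \<theta>) = 0" "cos (2 * real n * \<theta>) = - 1" "cos (real n * \<theta>) = 0"
      unfolding e by (simp_all only: sin_diff cos_diff sin_npi cos_npi) simp_all
    ultimately show ?thesis using j(2) unfolding \<theta>_def by blast
  qed
  thus "\<exists>\<theta>\<in>{0..pi}. x = cos \<theta> \<and> sin (2 * real n * \<theta>) = 0 \<and> cos (2 * real n * \<theta>) = - 1"
    if "x \<in> fejer1_nodes n" for x using that by blast
  have "interp_rule fejer1_nodes w n (cheb_T n) = (\<Sum>m<n. 0 * moment w m)"
  proof (rule interp_rule_cheb_combination[where nodes = fejer1_nodes and n = n, OF card_fejer1_nodes _ nodes_subset(2) w])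
    fix x assume "x \<in> fejer1_nodes n"
    then obtain \<theta> where "\<theta> \<in> {0..pi}" "x = cos \<theta>" "cos (real n * \<theta>) = 0" using angle by blast
    thus "cheb_T n x = (\<Sum>m<n. 0 * cheb_T m x)" by (simp add: cheb_T_cos)
  qed (use n in simp)
  moreover have "(\<Sum>m<n. \<bar>interp_rule fejer1_nodes w n (cheb_T m)\<bar>) = (\<Sum>m<n. \<bar>moment w m\<bar>)"
    using interp_rule_cheb_exact[where nodes = fejer1_nodes and n = n, OF card_fejer1_nodes _ nodes_subset(2) w] by (intro sum.cong) auto
  moreover have "0 \<le> (\<Sum>m<n. \<bar>moment w m\<bar>)" by (intro sum_nonneg) auto
  ultimately show "(\<Sum>m\<le>n. \<bar>interp_rule fejer1_nodes w n (cheb_T m)\<bar>) \<le> 4 * (\<Sum>m<n. \<bar>moment w m\<bar>)"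
    by (simp add: lessThan_Suc_atMost[symmetric])
qed (use n in auto)

text \<open>Here \<open>N = n - 1\<close>, so exactness covers all \<open>m \<le> N\<close>.\<close>

lemma clenshaw_curtis_aliasing:
  assumes n: "n \<ge> 2" and w: "set_integrable lborel {-1..1} w"
  shows "(\<forall>j. \<bar>clenshaw_curtis w n (cheb_T (j + 2 * (n - 1)))\<bar> = \<bar>clenshaw_curtis w n (cheb_T j)\<bar>) \<and>
    (\<Sum>j<2 * (n - 1). \<bar>clenshaw_curtis w n (cheb_T j)\<bar>) \<le> 8 * (\<Sum>m<n. \<bar>moment w m\<bar>)"
  unfolding clenshaw_curtis_def
proof (rule interp_rule_aliasing_of_base[where nodes = clenshaw_curtis_nodes and n = n, OF card_clenshaw_curtis_nodes[OF n] _ w, where \<sigma> = 1])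
  fix x assume x: "x \<in> clenshaw_curtis_nodes n"
  obtain j where j: "j \<in> {0..n - 1}" "x = cos (real j * pi / (real n - 1))"
    using x unfolding clenshaw_curtis_nodes_def by blast
  define \<theta> where "\<theta> = real j * pi / (real n - 1)"
  have e: "2 * real (n - 1) * \<theta> = real (2 * j) * pi"
    using n by (simp add: \<theta>_def of_nat_diff field_simps)
  have "real j * pi \<le> (real n - 1) * pi"
    using j n by (intro mult_right_mono) auto
  hence "\<theta> \<in> {0..pi}" using j n by (simp add: \<theta>_def divide_le_eq mult.commute)
  moreover have "sin (2 * real (n - 1) * \<theta>) = 0" "cos (2 * real (n - 1) * \<theta>) = 1"
    unfolding e by (simp_all only: sin_npi cos_npi) simp_all
  ultimately show "\<exists>\<theta>\<in>{0..pi}. x = cos \<theta> \<and> sin (2 * real (n - 1) * \<theta>) = 0 \<and> cos (2 * real (n - 1) * \<theta>) = 1"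
    using j(2) unfolding \<theta>_def by blast
next
  have lt: "{..n - 1} = {..<n}" using n by auto
  have "(\<Sum>m<n. \<bar>interp_rule clenshaw_curtis_nodes w n (cheb_T m)\<bar>) = (\<Sum>m<n. \<bar>moment w m\<bar>)"
    using interp_rule_cheb_exact[where nodes = clenshaw_curtis_nodes and n = n,
        OF card_clenshaw_curtis_nodes[OF n] _ nodes_subset(1) w] by (intro sum.cong) auto
  thus "(\<Sum>m\<le>n - 1. \<bar>interp_rule clenshaw_curtis_nodes w n (cheb_T m)\<bar>) \<le> 4 * (\<Sum>m<n. \<bar>moment w m\<bar>)"
    unfolding lt by (simp add: sum_nonneg)
qed (use n in auto)

text \<open>Here \<open>N = n + 1\<close>, so \<open>T\<^sub>n\<close> and \<open>T\<^sub>n\<^sub>+\<^sub>1\<close> must be reduced to lower degree. Since \<open>U\<^sub>n\<close> vanishes on the nodes, there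
\<open>U\<^sub>n\<^sub>+\<^sub>1 = - U\<^sub>n\<^sub>-\<^sub>1\<close>, and \<open>2 T\<^sub>m = U\<^sub>m - U\<^sub>m\<^sub>-\<^sub>2\<close> becomes \<open>2 T\<^sub>n = - U\<^sub>n\<^sub>-\<^sub>2\<close> and \<open>T\<^sub>n\<^sub>+\<^sub>1 = - U\<^sub>n\<^sub>-\<^sub>1\<close>. The cosine expansion of
\<open>U\<close> has bounded coefficients, so these two values of the rule are at most \<open>S\<close> and \<open>2 S\<close>, with \<open>S\<close> the sum of
the \<open>\<bar>moment w m\<bar>\<close> over \<open>m < n\<close>.\<close>

lemma fejer2_aliasing:
  assumes n: "n \<ge> 2" and w: "set_integrable lborel {-1..1} w"
  shows "(\<forall>j. \<bar>fejer2 w n (cheb_T (j + 2 * (n + 1)))\<bar> = \<bar>fejer2 w n (cheb_T j)\<bar>) \<and>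
    (\<Sum>j<2 * (n + 1). \<bar>fejer2 w n (cheb_T j)\<bar>) \<le> 8 * (\<Sum>m<n. \<bar>moment w m\<bar>)"
  unfolding fejer2_def
proof (rule interp_rule_aliasing_of_base[where nodes = fejer2_nodes and n = n, OF card_fejer2_nodes _ w, where \<sigma> = 1])
  have angle: "\<exists>\<theta>\<in>{0..pi}. x = cos \<theta> \<and> sin \<theta> \<noteq> 0 \<and> sin (real (n + 1) * \<theta>) = 0 \<and>
      sin (2 * real (n + 1) * \<theta>) = 0 \<and> cos (2 * real (n + 1) * \<theta>) = 1"
    if x: "x \<in> fejer2_nodes n" for x
  proof -
    obtain j where j: "j \<in> {1..n}" "x = cos (real j * pi / (real n + 1))"
      using x unfolding fejer2_nodes_def by blast
    define \<theta> where "\<theta> = real j * pi / (real n + 1)"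
    have e: "real (n + 1) * \<theta> = real j * pi" "2 * real (n + 1) * \<theta> = real (2 * j) * pi"
      by (simp_all add: \<theta>_def field_simps)
    have "real j * pi < (real n + 1) * pi"
      using j by (intro mult_strict_right_mono) auto
    hence \<theta>: "0 < \<theta>" "\<theta> < pi" using j by (simp_all add: \<theta>_def divide_less_eq mult.commute)
    moreover have "sin \<theta> \<noteq> 0" using sin_gt_zero[OF \<theta>] by simp
    moreover have "sin (real (n + 1) * \<theta>) = 0" "sin (2 * real (n + 1) * \<theta>) = 0" "cos (2 * real (n + 1) * \<theta>) = 1"
      unfolding e by (simp_all only: sin_npi cos_npi) simp_all
    ultimately show ?thesis
      using j(2) unfolding \<theta>_def[symmetric] by (intro bexI[of _ \<theta>]) auto
  qed
  thus "\<exists>\<theta>\<in>{0..pi}. x = cos \<theta> \<and> sin (2 * real (n + 1) * \<theta>) = 0 \<and> cos (2 * real (n + 1) * \<theta>) = 1"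
    if "x \<in> fejer2_nodes n" for x using that by blast
  define S where "S = (\<Sum>m<n. \<bar>moment w m\<bar>)"
  have bound: "\<bar>\<Sum>m<n. r m * moment w m\<bar> \<le> C * S" if "\<And>m. \<bar>r m\<bar> \<le> C" for r C
  proof -
    have "\<bar>\<Sum>m<n. r m * moment w m\<bar> \<le> (\<Sum>m<n. C * \<bar>moment w m\<bar>)"
      by (rule order.trans[OF sum_abs], intro sum_mono) (auto simp: abs_mult intro: mult_right_mono that)
    thus ?thesis by (simp add: S_def sum_distrib_left)
  qed
  have b1: "\<bar>interp_rule fejer2_nodes w n (cheb_T n)\<bar> \<le> 1 * S"
  proof -
    obtain d where d: "\<And>i. 0 \<le> d i \<and> d i \<le> (1::real)"
      "\<And>\<theta>. 2 * sin \<theta> * (\<Sum>i\<le>n - 2. d i * cos (real i * \<theta>)) = sin (real (n - 2 + 1) * \<theta>)"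
      using sin_multiple_as_cos_sum[of "n - 2"] by blast
    define r where "r i = (if i \<le> n - 2 then - d i else 0)" for i
    have "interp_rule fejer2_nodes w n (cheb_T n) = (\<Sum>m<n. r m * moment w m)"
    proof (rule interp_rule_cheb_combination[where nodes = fejer2_nodes and n = n, OF card_fejer2_nodes _ nodes_subset(3) w])
      fix x assume "x \<in> fejer2_nodes n"
      then obtain \<theta> where \<theta>: "\<theta> \<in> {0..pi}" "x = cos \<theta>" "sin \<theta> \<noteq> 0" "sin (real (n + 1) * \<theta>) = 0"
        using angle by blast
      define D where "D = (\<Sum>i\<le>n - 2. d i * cos (real i * \<theta>))"
      have "real (n - 2 + 1) = real n - 1" using n by (simp add: of_nat_diff)
      hence D: "2 * sin \<theta> * D = sin (real n * \<theta> - \<theta>)"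
        using d(2)[of \<theta>] by (simp add: D_def left_diff_distrib)
      have "sin (real n * \<theta> + \<theta>) = 0" using \<theta>(4) by (simp add: algebra_simps)
      hence "sin (real n * \<theta>) * cos \<theta> + cos (real n * \<theta>) * sin \<theta> = 0"
        unfolding sin_add .
      moreover have "2 * sin \<theta> * D = sin (real n * \<theta>) * cos \<theta> - cos (real n * \<theta>) * sin \<theta>"
        unfolding D by (rule sin_diff)
      ultimately have "2 * sin \<theta> * (cos (real n * \<theta>) + D) = 0"
        by algebra
      hence "cos (real n * \<theta>) = - D"
        using \<theta>(3) by (simp add: eq_neg_iff_add_eq_0)
      also have "\<dots> = (\<Sum>i\<in>{..n - 2}. r i * cos (real i * \<theta>))"
        by (simp add: D_def r_def sum_negf)
      also have "\<dots> = (\<Sum>i<n. r i * cos (real i * \<theta>))"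
        by (rule sum.mono_neutral_left) (use n in \<open>auto simp: r_def\<close>)
      finally show "cheb_T n x = (\<Sum>m<n. r m * cheb_T m x)"
        using \<theta>(1,2) by (simp add: cheb_T_cos)
    qed (use n in simp)
    thus ?thesis using bound[of r 1] d(1) by (simp add: r_def)
  qed
  have b2: "\<bar>interp_rule fejer2_nodes w n (cheb_T (n + 1))\<bar> \<le> 2 * S"
  proof -
    obtain d where d: "\<And>i. 0 \<le> d i \<and> d i \<le> (1::real)"
      "\<And>\<theta>. 2 * sin \<theta> * (\<Sum>i\<le>n - 1. d i * cos (real i * \<theta>)) = sin (real (n - 1 + 1) * \<theta>)"
      using sin_multiple_as_cos_sum[of "n - 1"] by blast
    define r where "r i = - 2 * d i" for i
    have "interp_rule fejer2_nodes w n (cheb_T (n + 1)) = (\<Sum>m<n. r m * moment w m)"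
    proof (rule interp_rule_cheb_combination[where nodes = fejer2_nodes and n = n, OF card_fejer2_nodes _ nodes_subset(3) w])
      fix x assume "x \<in> fejer2_nodes n"
      then obtain \<theta> where \<theta>: "\<theta> \<in> {0..pi}" "x = cos \<theta>" "sin \<theta> \<noteq> 0" "sin (real (n + 1) * \<theta>) = 0"
        using angle by blast
      define D where "D = (\<Sum>i\<le>n - 1. d i * cos (real i * \<theta>))"
      have "2 * sin \<theta> * D = sin (real n * \<theta>)" using d(2)[of \<theta>] n by (simp add: D_def)
      also have "real n * \<theta> = real (n + 1) * \<theta> - \<theta>" by (simp add: algebra_simps)
      also have "sin \<dots> = - (cos (real (n + 1) * \<theta>) * sin \<theta>)"
        unfolding sin_diff \<theta>(4) by simp
      finally have "cos (real (n + 1) * \<theta>) * sin \<theta> = (- 2 * D) * sin \<theta>" by algebra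
      hence "cos (real (n + 1) * \<theta>) = - 2 * D" using \<theta>(3) unfolding mult_cancel_right by blast
      also have "\<dots> = (\<Sum>i\<le>n - 1. r i * cos (real i * \<theta>))"
        by (simp add: D_def r_def sum_distrib_left mult.assoc sum_negf)
      also have "{..n - 1} = {..<n}" using n by auto
      finally show "cheb_T (n + 1) x = (\<Sum>m<n. r m * cheb_T m x)"
        using \<theta>(1) unfolding \<theta>(2) by (simp only: cheb_T_cos)
    qed (use n in simp)
    thus ?thesis using bound[of r 2] d(1) by (simp add: r_def abs_mult)
  qed
  have "(\<Sum>m<n. \<bar>interp_rule fejer2_nodes w n (cheb_T m)\<bar>) = S"
    unfolding S_def using interp_rule_cheb_exact[where nodes = fejer2_nodes and n = n, OF card_fejer2_nodes _ nodes_subset(3) w] by (intro sum.cong) auto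
  moreover have "{..n + 1} = insert (n + 1) (insert n {..<n})" by auto
  ultimately show "(\<Sum>m\<le>n + 1. \<bar>interp_rule fejer2_nodes w n (cheb_T m)\<bar>) \<le> 4 * S"
    using b1 b2 by simp
qed (use n in auto)

lemma rule_aliasing:
  assumes I: "I \<in> {clenshaw_curtis, fejer1, fejer2}" and n: "n \<ge> 2"
    and w: "set_integrable lborel {-1..1} w"
  shows "\<exists>N. n \<le> 2 * N \<and> (\<forall>j. \<bar>I w n (cheb_T (j + 2 * N))\<bar> = \<bar>I w n (cheb_T j)\<bar>) \<and>
    (\<Sum>j<2 * N. \<bar>I w n (cheb_T j)\<bar>) \<le> 8 * (\<Sum>m<n. \<bar>moment w m\<bar>)"
proof -
  consider "I = clenshaw_curtis" | "I = fejer1" | "I = fejer2" using I by blast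
  thus ?thesis
  proof cases
    case 1
    thus ?thesis using clenshaw_curtis_aliasing[OF n w] n by (intro exI[of _ "n - 1"]) simp
  next
    case 2
    thus ?thesis using fejer1_aliasing[OF n w] by (intro exI[of _ n]) simp
  next
    case 3
    thus ?thesis using fejer2_aliasing[OF n w] by (intro exI[of _ "n + 1"]) simp
  qed
qed

section \<open>The quadrature error of a Chebyshev series\<close>

text \<open>The mean value theorem bounds the difference on the right below by \<open>s * z powr (-s-1)\<close> with some
\<open>z < j + 1 \<le> 2j\<close>; the factor \<open>2 powr (s + 1)\<close> pays for replacing \<open>z\<close> by \<open>j\<close>.\<close>

lemma powr_le_telescope:
  assumes s: "s > 0" and j: "j \<ge> (1::nat)"
  shows "real j powr (- s - 1) \<le> 2 powr (s + 1) / s * (real j powr (- s) - real (Suc j) powr (- s))"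
proof -
  have "\<exists>z. real j < z \<and> z < real (Suc j) \<and>
      real (Suc j) powr (- s) - real j powr (- s) = (real (Suc j) - real j) * (- s * z powr (- s - 1))"
  proof (rule MVT2)
    show "((\<lambda>x. x powr (- s)) has_real_derivative - s * x powr (- s - 1)) (at x)"
      if "real j \<le> x" for x
      using that j by (intro has_real_derivative_powr) auto
  qed simp
  then obtain z where z: "real j < z" "z < real (Suc j)"
      "real j powr (- s) - real (Suc j) powr (- s) = s * z powr (- s - 1)" by auto
  have "(2 * real j) powr (- s - 1) \<le> z powr (- s - 1)"
    using z j s by (intro powr_mono2') auto
  hence "real j powr (- s - 1) \<le> 2 powr (s + 1) * z powr (- s - 1)"
    using j by (simp add: powr_mult powr_diff powr_minus powr_add field_simps)
  thus ?thesis unfolding z(3) using s by simp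
qed

lemma sum_powr_tail_le:
  assumes s: "s > 0" and n: "n \<ge> (1::nat)"
  shows "(\<Sum>j=n..K. real j powr (- s - 1)) \<le> 2 powr (s + 1) / s * real n powr (- s)"
proof (cases "n \<le> K")
  case True
  have "(\<Sum>j=n..K. real j powr (- s - 1))
      \<le> (\<Sum>j=n..K. 2 powr (s + 1) / s * (real j powr (- s) - real (Suc j) powr (- s)))"
    using n by (intro sum_mono powr_le_telescope[OF s]) auto
  also have "\<dots> = 2 powr (s + 1) / s * (\<Sum>j=n..K. real j powr (- s) - real (Suc j) powr (- s))"
    by (simp add: sum_distrib_left)
  also have "(\<Sum>j=n..K. real j powr (- s) - real (Suc j) powr (- s))
      = real n powr (- s) - real (Suc K) powr (- s)"
    using sum_Suc_diff[of n K "\<lambda>j. - (real j powr (- s))"] True by simp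
  also have "2 powr (s + 1) / s * (real n powr (- s) - real (Suc K) powr (- s))
      \<le> 2 powr (s + 1) / s * real n powr (- s)"
    using s by (intro mult_left_mono) auto
  finally show ?thesis .
qed (use s in simp)

lemma summable_Suc_powr: "s > 0 \<Longrightarrow> summable (\<lambda>q. real (Suc q) powr (- s - 1))"
  using summable_Suc_iff[of "\<lambda>q. real q powr (- s - 1)"] by (simp add: summable_real_powr_iff)

text \<open>On the \<open>q\<close>-th period, indices \<open>j \<ge> n\<close> satisfy \<open>j \<ge> (q + 1) n / 2\<close> (for \<open>q = 0\<close> this is \<open>j \<ge> n\<close>, for \<open>q > 0\<close>
it uses \<open>n \<le> 2N\<close>), so \<open>j powr (-s-1)\<close> is at most \<open>((q + 1) n / 2) powr (-s-1)\<close> there, which is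
summable over \<open>q\<close>.\<close>

lemma sum_powr_periodic_le:
  fixes B :: "nat \<Rightarrow> real"
  assumes s: "s > 0" and n: "n \<ge> 1" and nN: "n \<le> 2 * N"
    and B: "\<And>j. 0 \<le> B j" and per: "\<And>j. B (j + 2 * N) = B j"
  shows "(\<Sum>j=n..K. real j powr (- s - 1) * B j)
    \<le> 2 powr (s + 1) * (\<Sum>q. real (Suc q) powr (- s - 1)) * real n powr (- s - 1) * (\<Sum>r<2 * N. B r)"
proof -
  define P where "P = (\<Sum>r<2 * N. B r)"
  have P: "0 \<le> P" unfolding P_def by (intro sum_nonneg B)
  define f where "f j = (if n \<le> j then real j powr (- s - 1) * B j else 0)" for j
  have f0: "0 \<le> f j" for j by (simp add: f_def B)
  have per': "B (j + q * (2 * N)) = B j" for j q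
    by (induction q) (use per[of "j + _ * (2 * N)"] in \<open>simp_all add: add_ac\<close>)
  have block: "sum f {q * (2 * N)..<q * (2 * N) + 2 * N}
      \<le> 2 powr (s + 1) * real n powr (- s - 1) * P * real (Suc q) powr (- s - 1)" for q
  proof -
    have "sum f {q * (2 * N)..<q * (2 * N) + 2 * N}
        \<le> (\<Sum>j\<in>{q * (2 * N)..<q * (2 * N) + 2 * N}. (real (Suc q) * real n / 2) powr (- s - 1) * B j)"
    proof (rule sum_mono)
      fix j assume j: "j \<in> {q * (2 * N)..<q * (2 * N) + 2 * N}"
      show "f j \<le> (real (Suc q) * real n / 2) powr (- s - 1) * B j"
      proof (cases "n \<le> j")
        case True
        have "q * n \<le> q * (2 * N)" using nN by simp
        hence "q * n \<le> j" using j by (meson atLeastLessThan_iff order.trans)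
        hence "Suc q * n \<le> 2 * j" using True by simp
        hence "real (Suc q * n) \<le> real (2 * j)" by (simp only: of_nat_le_iff)
        hence "real (Suc q) * real n / 2 \<le> real j" unfolding of_nat_mult by simp
        hence "real j powr (- s - 1) \<le> (real (Suc q) * real n / 2) powr (- s - 1)"
          using n s by (intro powr_mono2') auto
        thus ?thesis using True B by (simp add: f_def mult_right_mono)
      qed (simp add: f_def B)
    qed
    also have "\<dots> = (real (Suc q) * real n / 2) powr (- s - 1) * (\<Sum>j\<in>{q * (2 * N)..<q * (2 * N) + 2 * N}. B j)"
      by (simp add: sum_distrib_left)
    also have "(\<Sum>j\<in>{q * (2 * N)..<q * (2 * N) + 2 * N}. B j) = P"
    proof -
      have "B (j - q * (2 * N)) = B j" if "q * (2 * N) \<le> j" for j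
        using per'[of "j - q * (2 * N)" q] that by simp
      thus ?thesis
        unfolding P_def
        by (intro sum.reindex_bij_witness[of _ "\<lambda>r. r + q * (2 * N)" "\<lambda>j. j - q * (2 * N)"]) auto
    qed
    also have "(real (Suc q) * real n / 2) powr (- s - 1) * P
        = 2 powr (s + 1) * real n powr (- s - 1) * P * real (Suc q) powr (- s - 1)"
    proof -
      have "(real (Suc q) * real n / 2) powr (- s - 1)
          = real (Suc q) powr (- s - 1) * real n powr (- s - 1) / 2 powr (- s - 1)"
        by (simp only: powr_mult powr_divide)
      also have "\<dots> = 2 powr (s + 1) * real n powr (- s - 1) * real (Suc q) powr (- s - 1)"
        using powr_minus_divide[of 2 "s + 1"] by (simp add: mult_ac)
      finally show ?thesis by (simp add: mult_ac)
    qed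
    finally show ?thesis .
  qed
  have N: "N \<ge> 1" using n nN by simp
  have "(\<Sum>j=n..K. real j powr (- s - 1) * B j) = sum f {n..K}"
    by (intro sum.cong) (auto simp: f_def)
  also have "\<dots> \<le> sum f {..<Suc K * (2 * N)}"
  proof (intro sum_mono2 f0)
    have "Suc K * 1 \<le> Suc K * (2 * N)" using N by (intro mult_left_mono) auto
    thus "{n..K} \<subseteq> {..<Suc K * (2 * N)}" by auto
  qed auto
  also have "\<dots> = (\<Sum>q<Suc K. sum f {q * (2 * N)..<q * (2 * N) + 2 * N})"
    by (rule sum.nat_group[symmetric])
  also have "\<dots> \<le> (\<Sum>q<Suc K. 2 powr (s + 1) * real n powr (- s - 1) * P * real (Suc q) powr (- s - 1))"
    by (intro sum_mono block)
  also have "\<dots> = 2 powr (s + 1) * real n powr (- s - 1) * P * (\<Sum>q<Suc K. real (Suc q) powr (- s - 1))"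
    by (simp only: sum_distrib_left)
  also have "\<dots> \<le> 2 powr (s + 1) * real n powr (- s - 1) * P * (\<Sum>q. real (Suc q) powr (- s - 1))"
    by (intro mult_left_mono sum_le_suminf summable_Suc_powr s) (auto simp: P)
  finally show ?thesis by (simp add: P_def mult_ac)
qed

definition cheb_partial_sum :: "(real \<Rightarrow> real) \<Rightarrow> nat \<Rightarrow> real \<Rightarrow> real" where
  "cheb_partial_sum f K x = cheb_coeff f 0 / 2 + (\<Sum>j=1..K. cheb_coeff f j * cheb_T j x)"

lemma cheb_partial_sum_eq:
  "cheb_partial_sum f K x = (\<Sum>j\<le>K. (if j = 0 then cheb_coeff f 0 / 2 else cheb_coeff f j) * cheb_T j x)"
proof -
  have "{..K} = insert 0 {1..K}" by auto
  moreover have "(\<Sum>j\<in>{1..K}. (if j = 0 then cheb_coeff f 0 / 2 else cheb_coeff f j) * cheb_T j x)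
      = (\<Sum>j=1..K. cheb_coeff f j * cheb_T j x)"
    by (intro sum.cong) auto
  ultimately show ?thesis by (simp add: cheb_partial_sum_def cheb_T_def)
qed

lemma continuous_on_cheb_partial_sum: "continuous_on {-1..1} (cheb_partial_sum f K)"
  unfolding cheb_partial_sum_def by (intro continuous_intros continuous_on_cheb_T)

lemma set_integral_weight_tendsto:
  fixes w f :: "real \<Rightarrow> real"
  assumes w: "set_integrable lborel {-1..1} w" and lim: "uniform_limit {-1..1} S f sequentially"
    and S: "\<And>K. continuous_on {-1..1} (S K)"
  shows "(\<lambda>K. LINT x:{-1..1}|lborel. w x * S K x) \<longlonglongrightarrow> (LINT x:{-1..1}|lborel. w x * f x)"
proof -
  have f: "continuous_on {-1..1} f"
    by (rule uniform_limit_theorem[OF _ lim]) (auto simp: S)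
  note iS = set_integrable_mult_continuous[OF w S] and if' = set_integrable_mult_continuous[OF w f]
  define W where "W = (LINT x:{-1..1}|lborel. \<bar>w x\<bar>)"
  have W: "0 \<le> W" unfolding W_def set_lebesgue_integral_def by (intro integral_nonneg_AE) simp
  have iw: "set_integrable lborel {-1..1} (\<lambda>x. \<bar>w x\<bar>)" using w by (rule set_integrable_abs)
  show ?thesis
  proof (rule metric_LIMSEQ_I)
    fix r :: real assume r: "0 < r"
    define e where "e = r / (W + 1)"
    have e: "0 < e" using r W by (simp add: e_def)
    obtain K0 where K0: "\<And>K x. K \<ge> K0 \<Longrightarrow> x \<in> {-1..1} \<Longrightarrow> dist (S K x) (f x) < e"
      using uniform_limitD[OF lim e] unfolding eventually_sequentially by blast
    have "dist (LINT x:{-1..1}|lborel. w x * S K x) (LINT x:{-1..1}|lborel. w x * f x) < r" if K: "K \<ge> K0" for K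
    proof -
      have "(LINT x:{-1..1}|lborel. w x * S K x) - (LINT x:{-1..1}|lborel. w x * f x)
          = (LINT x:{-1..1}|lborel. w x * S K x - w x * f x)"
        by (rule set_integral_diff(2)[OF iS if', symmetric])
      also have "\<bar>\<dots>\<bar> \<le> (LINT x:{-1..1}|lborel. \<bar>w x\<bar> * e)"
        unfolding set_lebesgue_integral_def
      proof (rule integral_abs_bound_integral)
        show "integrable lborel (\<lambda>x. indicator {-1..1} x *\<^sub>R (w x * S K x - w x * f x))"
          using set_integral_diff(1)[OF iS if'] unfolding set_integrable_def .
        show "integrable lborel (\<lambda>x. indicator {-1..1} x *\<^sub>R (\<bar>w x\<bar> * e))"
          using set_integrable_mult_left[of e, OF iw] unfolding set_integrable_def .
        show "\<bar>indicator {-1..1} x *\<^sub>R (w x * S K x - w x * f x)\<bar> \<le> indicator {-1..1} x *\<^sub>R (\<bar>w x\<bar> * e)" for x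
        proof (cases "x \<in> {-1..1}")
          case True
          have "\<bar>w x\<bar> * \<bar>S K x - f x\<bar> \<le> \<bar>w x\<bar> * e"
            using K0[OF K True] by (intro mult_left_mono) (auto simp: dist_real_def)
          thus ?thesis using True by (simp add: abs_mult flip: right_diff_distrib)
        qed simp
      qed
      also have "\<dots> = W * e" unfolding W_def by (rule set_integral_mult_left)
      also have "\<dots> < r" using r W by (simp add: e_def field_simps)
      finally show ?thesis by (simp add: dist_real_def)
    qed
    thus "\<exists>K0. \<forall>K\<ge>K0. dist (LINT x:{-1..1}|lborel. w x * S K x) (LINT x:{-1..1}|lborel. w x * f x) < r" by blast
  qed
qed

text \<open>On a partial sum of the Chebyshev series the error is a finite combination of the errors of the \<open>T\<^sub>j\<close>,
and the bound does not depend on the length of the partial sum. It passes to the limit because both the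
integral and the rule are continuous under uniform convergence.\<close>

lemma quad_error_le:
  assumes s: "s > 0" and I: "I \<in> {clenshaw_curtis, fejer1, fejer2}" and n: "n \<ge> 2"
    and w: "set_integrable lborel {-1..1} w" and f: "is_cheb_series_sum f"
    and A: "\<And>j. j \<ge> n \<Longrightarrow> \<bar>cheb_coeff f j\<bar> \<le> A * real j powr (- s - 1)"
    and \<mu>: "\<And>j. j \<ge> n \<Longrightarrow> \<bar>moment w j\<bar> \<le> \<mu>"
  shows "\<bar>quad_error I w f n\<bar> \<le> A * (2 powr (s + 1) / s * real n powr (- s) * \<mu>
      + 8 * 2 powr (s + 1) * (\<Sum>q. real (Suc q) powr (- s - 1)) * real n powr (- s - 1) * (\<Sum>m<n. \<bar>moment w m\<bar>))"
    (is "_ \<le> ?bound")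
proof -
  obtain nodes where I_eq: "I = interp_rule nodes" and card: "card (nodes n) = n" and X: "nodes n \<subseteq> {-1..1}"
    using rule_is_interp_rule[OF I] n by blast
  have n1: "n \<ge> 1" using n by simp
  obtain c where c: "\<And>g. I w n g = (\<Sum>x\<in>nodes n. c x * g x)"
    using interp_rule_weighted_sum[where nodes = nodes and n = n, OF card n1 w] unfolding I_eq by blast
  obtain N where N: "n \<le> 2 * N" "\<And>j. \<bar>I w n (cheb_T (j + 2 * N))\<bar> = \<bar>I w n (cheb_T j)\<bar>"
    "(\<Sum>j<2 * N. \<bar>I w n (cheb_T j)\<bar>) \<le> 8 * (\<Sum>m<n. \<bar>moment w m\<bar>)"
    using rule_aliasing[OF I n w] by blast
  have A0: "0 \<le> A"
    using A[of n] n by (smt (verit) mult_neg_pos of_nat_0_less_iff powr_gt_zero order_refl zero_less_iff_neq_zero not_numeral_le_zero)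
  have \<mu>0: "0 \<le> \<mu>" using \<mu>[of n] by simp
  define b where "b j = (if j = 0 then cheb_coeff f 0 / 2 else cheb_coeff f j)" for j
  define err where "err j = moment w j - I w n (cheb_T j)" for j
  have err0: "err j = 0" if "j < n" for j
    using interp_rule_cheb_exact[where nodes = nodes and n = n, OF card that X w] by (simp add: err_def I_eq)
  have eK: "quad_error I w (cheb_partial_sum f K) n = (\<Sum>j=n..K. cheb_coeff f j * err j)" for K
  proof -
    have "quad_error I w (cheb_partial_sum f K) n = (\<Sum>j\<le>K. b j * err j)"
    proof -
      have 1: "(LINT x:{-1..1}|lborel. w x * cheb_partial_sum f K x) = (\<Sum>j\<le>K. b j * moment w j)"
        unfolding cheb_partial_sum_eq b_def[symmetric] moment_def
        by (rule set_lebesgue_integral_weighted_sum[OF w]) (auto intro: continuous_on_cheb_T)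
      have "I w n (cheb_partial_sum f K) = (\<Sum>x\<in>nodes n. \<Sum>j\<le>K. b j * (c x * cheb_T j x))"
        unfolding c cheb_partial_sum_eq b_def[symmetric] by (simp add: sum_distrib_left mult_ac)
      also have "\<dots> = (\<Sum>j\<le>K. \<Sum>x\<in>nodes n. b j * (c x * cheb_T j x))" by (rule sum.swap)
      also have "\<dots> = (\<Sum>j\<le>K. b j * I w n (cheb_T j))" unfolding c by (simp add: sum_distrib_left)
      finally show ?thesis
        unfolding quad_error_def 1 err_def by (simp add: right_diff_distrib sum_subtractf)
    qed
    also have "\<dots> = (\<Sum>j=n..K. b j * err j)"
      by (rule sum.mono_neutral_right) (auto simp: err0)
    also have "\<dots> = (\<Sum>j=n..K. cheb_coeff f j * err j)"
      using n by (intro sum.cong) (auto simp: b_def)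
    finally show ?thesis .
  qed
  have bK: "\<bar>quad_error I w (cheb_partial_sum f K) n\<bar> \<le> ?bound" for K
  proof -
    have "\<bar>quad_error I w (cheb_partial_sum f K) n\<bar> \<le> (\<Sum>j=n..K. \<bar>cheb_coeff f j * err j\<bar>)"
      unfolding eK by (rule sum_abs)
    also have "\<dots> \<le> (\<Sum>j=n..K. A * (\<mu> * real j powr (- s - 1) + real j powr (- s - 1) * \<bar>I w n (cheb_T j)\<bar>))"
    proof (rule sum_mono)
      fix j assume j: "j \<in> {n..K}"
      have "\<bar>err j\<bar> \<le> \<mu> + \<bar>I w n (cheb_T j)\<bar>"
        unfolding err_def using \<mu>[of j] j by (intro order.trans[OF abs_triangle_ineq4]) auto
      hence "\<bar>cheb_coeff f j\<bar> * \<bar>err j\<bar> \<le> (A * real j powr (- s - 1)) * (\<mu> + \<bar>I w n (cheb_T j)\<bar>)"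
        using A[of j] j A0 by (intro mult_mono) auto
      thus "\<bar>cheb_coeff f j * err j\<bar>
          \<le> A * (\<mu> * real j powr (- s - 1) + real j powr (- s - 1) * \<bar>I w n (cheb_T j)\<bar>)"
        by (simp add: abs_mult algebra_simps)
    qed
    also have "\<dots> = A * (\<mu> * (\<Sum>j=n..K. real j powr (- s - 1))
        + (\<Sum>j=n..K. real j powr (- s - 1) * \<bar>I w n (cheb_T j)\<bar>))"
      by (simp only: sum_distrib_left[symmetric] sum.distrib)
    also have "\<dots> \<le> ?bound"
    proof (intro mult_left_mono add_mono A0)
      show "\<mu> * (\<Sum>j=n..K. real j powr (- s - 1)) \<le> 2 powr (s + 1) / s * real n powr (- s) * \<mu>"
        using mult_left_mono[OF sum_powr_tail_le[OF s n1] \<mu>0] by (simp add: mult_ac)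
      define Z where "Z = 2 powr (s + 1) * (\<Sum>q. real (Suc q) powr (- s - 1)) * real n powr (- s - 1)"
      have Z: "0 \<le> Z" unfolding Z_def by (intro mult_nonneg_nonneg suminf_nonneg summable_Suc_powr s) auto
      have "(\<Sum>j=n..K. real j powr (- s - 1) * \<bar>I w n (cheb_T j)\<bar>) \<le> Z * (\<Sum>j<2 * N. \<bar>I w n (cheb_T j)\<bar>)"
        unfolding Z_def by (rule sum_powr_periodic_le[where B = "\<lambda>j. \<bar>I w n (cheb_T j)\<bar>", OF s n1 N(1) _ N(2)]) simp
      also have "\<dots> \<le> Z * (8 * (\<Sum>m<n. \<bar>moment w m\<bar>))" by (rule mult_left_mono[OF N(3) Z])
      finally show "(\<Sum>j=n..K. real j powr (- s - 1) * \<bar>I w n (cheb_T j)\<bar>)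
          \<le> 8 * 2 powr (s + 1) * (\<Sum>q. real (Suc q) powr (- s - 1)) * real n powr (- s - 1) * (\<Sum>m<n. \<bar>moment w m\<bar>)"
        unfolding Z_def by (simp only: mult_ac)
    qed
    finally show ?thesis .
  qed
  have lim: "uniform_limit {-1..1} (cheb_partial_sum f) f sequentially"
    using f unfolding is_cheb_series_sum_def cheb_partial_sum_def[abs_def] .
  have "(\<lambda>K. I w n (cheb_partial_sum f K)) \<longlonglongrightarrow> I w n f"
    unfolding c by (intro tendsto_sum tendsto_mult tendsto_const tendsto_uniform_limitI[OF lim]) (use X in auto)
  hence "(\<lambda>K. quad_error I w (cheb_partial_sum f K) n) \<longlonglongrightarrow> quad_error I w f n"
    unfolding quad_error_def
    by (intro tendsto_diff set_integral_weight_tendsto[OF w lim] continuous_on_cheb_partial_sum)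
  hence "(\<lambda>K. \<bar>quad_error I w (cheb_partial_sum f K) n\<bar>) \<longlonglongrightarrow> \<bar>quad_error I w f n\<bar>"
    by (rule tendsto_rabs)
  thus ?thesis by (rule LIMSEQ_le_const2) (use bK in blast)
qed

section \<open>Growth of the moments and order of the error\<close>

lemma sum_powr_le:
  assumes \<delta>: "0 < \<delta>" "\<delta> < 1"
  shows "(\<Sum>m=1..n. real m powr (\<delta> - 1)) \<le> real n powr \<delta> / \<delta>"
proof (induction n)
  case (Suc n)
  have "real (Suc n) powr (\<delta> - 1) \<le> (real (Suc n) powr \<delta> - real n powr \<delta>) / \<delta>"
  proof (cases "n = 0")
    case False
    have "\<exists>z. real n < z \<and> z < real (Suc n) \<and>
        real (Suc n) powr \<delta> - real n powr \<delta> = (real (Suc n) - real n) * (\<delta> * z powr (\<delta> - 1))"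
    proof (rule MVT2)
      show "((\<lambda>x. x powr \<delta>) has_real_derivative \<delta> * x powr (\<delta> - 1)) (at x)" if "real n \<le> x" for x
        using that False by (intro has_real_derivative_powr) auto
    qed simp
    then obtain z where z: "real n < z" "z < real (Suc n)"
        "real (Suc n) powr \<delta> - real n powr \<delta> = \<delta> * z powr (\<delta> - 1)" by auto
    have "real (Suc n) powr (\<delta> - 1) \<le> z powr (\<delta> - 1)"
      using z False \<delta> by (intro powr_mono2') auto
    thus ?thesis unfolding z(3) using \<delta> by simp
  qed (use \<delta> in simp)
  thus ?case using Suc.IH by (simp add: diff_divide_distrib)
qed simp

lemma sum_inverse_le: "n \<ge> 1 \<Longrightarrow> (\<Sum>m=1..n. 1 / real m) \<le> 1 + ln (real n)"
proof (induction n rule: dec_induct)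
  case (step n)
  have "ln (real n / real (Suc n)) \<le> real n / real (Suc n) - 1"
    using step by (intro ln_le_minus_one) auto
  also have "\<dots> = - 1 / real (Suc n)" by (simp add: field_simps)
  finally have "1 / real (Suc n) \<le> ln (real (Suc n)) - ln (real n)"
    using step by (simp add: ln_div)
  thus ?case using step.IH by simp
qed simp

text \<open>The two quantities in which the error estimate measures the moments, both bounded through the same \<open>\<phi>\<close>.\<close>

definition moment_growth :: "(nat \<Rightarrow> real) \<Rightarrow> (nat \<Rightarrow> real) \<Rightarrow> bool" where
  "moment_growth \<mu> \<phi> \<longleftrightarrow> (\<exists>C. \<forall>\<^sub>F n in sequentially.
     (\<Sum>m<n. \<bar>\<mu> m\<bar>) \<le> C * \<phi> n \<and> (\<forall>j\<ge>n. \<bar>\<mu> j\<bar> \<le> C * \<phi> n / real n))"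

lemma moment_growthI:
  assumes "\<And>n. n \<ge> n0 \<Longrightarrow> (\<Sum>m<n. \<bar>\<mu> m\<bar>) \<le> C1 * \<phi> n"
    and "\<And>n j. n \<ge> n0 \<Longrightarrow> j \<ge> n \<Longrightarrow> \<bar>\<mu> j\<bar> \<le> C2 * \<phi> n / real n"
    and "\<And>n. n \<ge> n0 \<Longrightarrow> 0 \<le> \<phi> n"
  shows "moment_growth \<mu> \<phi>"
  unfolding moment_growth_def
proof (intro exI[of _ "max C1 C2"] eventually_sequentiallyI[of n0] conjI allI impI)
  fix n assume n: "n \<ge> n0"
  have "C1 * \<phi> n \<le> max C1 C2 * \<phi> n" by (intro mult_right_mono assms(3) n) auto
  thus "(\<Sum>m<n. \<bar>\<mu> m\<bar>) \<le> max C1 C2 * \<phi> n" using assms(1)[OF n] by linarith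
  have "C2 * \<phi> n / real n \<le> max C1 C2 * \<phi> n / real n"
    by (intro divide_right_mono mult_right_mono assms(3) n) auto
  thus "\<bar>\<mu> j\<bar> \<le> max C1 C2 * \<phi> n / real n" if "j \<ge> n" for j
    using assms(2)[OF n that] by linarith
qed

lemma sum_lessThan_le_split:
  fixes \<mu> g :: "nat \<Rightarrow> real"
  assumes m0: "m0 \<ge> 1" and \<mu>: "\<And>m. m \<ge> m0 \<Longrightarrow> m < n \<Longrightarrow> \<bar>\<mu> m\<bar> \<le> g m" and g: "\<And>m. m \<ge> 1 \<Longrightarrow> 0 \<le> g m"
  shows "(\<Sum>m<n. \<bar>\<mu> m\<bar>) \<le> (\<Sum>m<m0. \<bar>\<mu> m\<bar>) + (\<Sum>m=1..n. g m)"
proof -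
  have "(\<Sum>m<n. \<bar>\<mu> m\<bar>) \<le> (\<Sum>m\<in>{..<m0} \<union> {m0..<n}. \<bar>\<mu> m\<bar>)"
    by (intro sum_mono2) auto
  also have "\<dots> = (\<Sum>m<m0. \<bar>\<mu> m\<bar>) + (\<Sum>m\<in>{m0..<n}. \<bar>\<mu> m\<bar>)"
    by (intro sum.union_disjoint) auto
  also have "(\<Sum>m\<in>{m0..<n}. \<bar>\<mu> m\<bar>) \<le> (\<Sum>m\<in>{m0..<n}. g m)"
    by (intro sum_mono \<mu>) auto
  also have "\<dots> \<le> (\<Sum>m=1..n. g m)"
    using m0 g by (intro sum_mono2) auto
  finally show ?thesis by simp
qed

lemma moment_growth_summable:
  assumes \<kappa>: "\<kappa> > 0" and \<mu>: "\<And>m. m \<ge> 1 \<Longrightarrow> \<bar>\<mu> m\<bar> \<le> C * real m powr (- 1 - \<kappa>)"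
  shows "moment_growth \<mu> (\<lambda>_. 1)"
proof (rule moment_growthI[of 1])
  have C: "0 \<le> C" using \<mu>[of 1] by simp
  show "(\<Sum>m<n. \<bar>\<mu> m\<bar>) \<le> (\<bar>\<mu> 0\<bar> + C * (2 powr (\<kappa> + 1) / \<kappa>)) * 1" for n
  proof -
    have "(\<Sum>m<n. \<bar>\<mu> m\<bar>) \<le> (\<Sum>m<1. \<bar>\<mu> m\<bar>) + (\<Sum>m=1..n. C * real m powr (- 1 - \<kappa>))"
      by (rule sum_lessThan_le_split) (use \<mu> C in auto)
    also have "(\<Sum>m=1..n. C * real m powr (- 1 - \<kappa>)) = C * (\<Sum>m=1..n. real m powr (- \<kappa> - 1))"
      unfolding sum_distrib_left minus_diff_commute[of 1 \<kappa>] by simp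
    also have "\<dots> \<le> C * (2 powr (\<kappa> + 1) / \<kappa>)"
      using sum_powr_tail_le[OF \<kappa>, of 1 n] C by (intro mult_left_mono) auto
    finally show ?thesis by simp
  qed
  show "\<bar>\<mu> j\<bar> \<le> C * 1 / real n" if n: "n \<ge> 1" and j: "j \<ge> n" for n j
  proof -
    have "real j powr (- 1 - \<kappa>) \<le> real j powr (- 1)" using j n \<kappa> by (intro powr_mono) auto
    also have "\<dots> \<le> real n powr (- 1)" using j n by (intro powr_mono2') auto
    also have "\<dots> = 1 / real n" using n by (simp add: powr_minus_divide)
    finally have "C * real j powr (- 1 - \<kappa>) \<le> C * (1 / real n)" by (rule mult_left_mono[OF _ C])
    thus ?thesis using \<mu>[of j] n j by simp
  qed
qed auto

lemma moment_growth_powr: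
  assumes \<delta>: "0 < \<delta>" "\<delta> < 1" and \<mu>: "\<And>m. m \<ge> 1 \<Longrightarrow> \<bar>\<mu> m\<bar> \<le> C * real m powr (\<delta> - 1)"
  shows "moment_growth \<mu> (\<lambda>n. real n powr \<delta>)"
proof (rule moment_growthI[of 1])
  have C: "0 \<le> C" using \<mu>[of 1] by simp
  show "(\<Sum>m<n. \<bar>\<mu> m\<bar>) \<le> (\<bar>\<mu> 0\<bar> + C / \<delta>) * real n powr \<delta>" if n: "n \<ge> 1" for n
  proof -
    have "(\<Sum>m<n. \<bar>\<mu> m\<bar>) \<le> (\<Sum>m<1. \<bar>\<mu> m\<bar>) + (\<Sum>m=1..n. C * real m powr (\<delta> - 1))"
      by (rule sum_lessThan_le_split) (use \<mu> C in auto)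
    also have "(\<Sum>m=1..n. C * real m powr (\<delta> - 1)) = C * (\<Sum>m=1..n. real m powr (\<delta> - 1))"
      by (simp add: sum_distrib_left)
    also have "\<dots> \<le> C * (real n powr \<delta> / \<delta>)"
      by (rule mult_left_mono[OF sum_powr_le[OF \<delta>] C])
    also have "(\<Sum>m<1. \<bar>\<mu> m\<bar>) \<le> \<bar>\<mu> 0\<bar> * real n powr \<delta>"
      using n \<delta> mult_left_mono[of 1 "real n powr \<delta>" "\<bar>\<mu> 0\<bar>"] by (simp add: ge_one_powr_ge_zero)
    finally show ?thesis by (simp add: distrib_right)
  qed
  show "\<bar>\<mu> j\<bar> \<le> C * real n powr \<delta> / real n" if n: "n \<ge> 1" and j: "j \<ge> n" for n j
  proof -
    have "real j powr (\<delta> - 1) \<le> real n powr (\<delta> - 1)" using j n \<delta> by (intro powr_mono2') auto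
    also have "\<dots> = real n powr \<delta> / real n" using n by (simp add: powr_diff)
    finally have "C * real j powr (\<delta> - 1) \<le> C * (real n powr \<delta> / real n)" by (rule mult_left_mono[OF _ C])
    thus ?thesis using \<mu>[of j] n j by simp
  qed
qed auto

lemma one_le_ln_nat: "1 \<le> ln (real n)" if "n \<ge> 3"
proof -
  have "exp 1 \<le> real n" using exp_le that by linarith
  thus ?thesis using that by (subst ln_ge_iff) auto
qed

lemma moment_growth_ln:
  assumes \<mu>: "\<And>m. m \<ge> 1 \<Longrightarrow> \<bar>\<mu> m\<bar> \<le> C / real m"
  shows "moment_growth \<mu> (\<lambda>n. ln (real n))"
proof (rule moment_growthI[of 3])
  have C: "0 \<le> C" using \<mu>[of 1] by simp
  show "(\<Sum>m<n. \<bar>\<mu> m\<bar>) \<le> (\<bar>\<mu> 0\<bar> + 2 * C) * ln (real n)" if n: "n \<ge> 3" for n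
  proof -
    have "(\<Sum>m<n. \<bar>\<mu> m\<bar>) \<le> (\<Sum>m<1. \<bar>\<mu> m\<bar>) + (\<Sum>m=1..n. C * (1 / real m))"
      by (rule sum_lessThan_le_split) (use \<mu> C in auto)
    also have "(\<Sum>m=1..n. C * (1 / real m)) = C * (\<Sum>m=1..n. 1 / real m)"
      by (simp only: sum_distrib_left)
    also have "\<dots> \<le> C * (2 * ln (real n))"
      using sum_inverse_le[of n] one_le_ln_nat[OF n] n by (intro mult_left_mono C) auto
    also have "(\<Sum>m<1. \<bar>\<mu> m\<bar>) \<le> \<bar>\<mu> 0\<bar> * ln (real n)"
      using mult_left_mono[OF one_le_ln_nat[OF n], of "\<bar>\<mu> 0\<bar>"] by simp
    finally show ?thesis by (simp add: distrib_right)
  qed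
  show "\<bar>\<mu> j\<bar> \<le> C * ln (real n) / real n" if n: "n \<ge> 3" and j: "j \<ge> n" for n j
  proof -
    have "\<bar>\<mu> j\<bar> \<le> C / real j" using \<mu> n j by simp
    also have "\<dots> \<le> C / real n" using n j C by (intro divide_left_mono) auto
    also have "\<dots> \<le> C * ln (real n) / real n"
      using mult_left_mono[OF one_le_ln_nat[OF n] C] by (intro divide_right_mono) auto
    finally show ?thesis .
  qed
qed (use one_le_ln_nat in force)

text \<open>The function \<open>m powr (\<delta> - 1) * ln m\<close> decreases only from some point on. The tail is controlled instead by
\<open>ln j = ln n + ln (j/n) \<le> ln n + (j/n) powr \<epsilon> / \<epsilon>\<close> with \<open>\<epsilon> = 1 - \<delta>\<close>, whose second part is cancelled by \<open>j powr (-\<epsilon>)\<close>.\<close>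

lemma moment_growth_powr_ln:
  assumes \<delta>: "0 < \<delta>" "\<delta> < 1" and C: "0 \<le> C"
    and \<mu>: "\<forall>\<^sub>F m in sequentially. \<bar>\<mu> m\<bar> \<le> C * real m powr (\<delta> - 1) * ln (real m)"
  shows "moment_growth \<mu> (\<lambda>n. real n powr \<delta> * ln (real n))"
proof -
  obtain m1 where m1: "\<And>m. m \<ge> m1 \<Longrightarrow> \<bar>\<mu> m\<bar> \<le> C * real m powr (\<delta> - 1) * ln (real m)"
    using \<mu> unfolding eventually_sequentially by blast
  define m0 where "m0 = max 3 m1"
  define S0 where "S0 = (\<Sum>m<m0. \<bar>\<mu> m\<bar>)"
  show ?thesis
  proof (rule moment_growthI[of m0])
    show "(\<Sum>m<n. \<bar>\<mu> m\<bar>) \<le> (S0 + C / \<delta>) * (real n powr \<delta> * ln (real n))" if "n \<ge> m0" for n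
    proof -
      have n: "n \<ge> 3" using that by (simp add: m0_def)
      note ln1 = one_le_ln_nat[OF n]
      have "(\<Sum>m<n. \<bar>\<mu> m\<bar>) \<le> S0 + (\<Sum>m=1..n. C * ln (real n) * real m powr (\<delta> - 1))"
        unfolding S0_def
      proof (rule sum_lessThan_le_split)
        fix m assume m: "m \<ge> m0" "m < n"
        have "C * real m powr (\<delta> - 1) * ln (real m) \<le> C * real m powr (\<delta> - 1) * ln (real n)"
          using m C by (intro mult_left_mono) (auto simp: m0_def)
        thus "\<bar>\<mu> m\<bar> \<le> C * ln (real n) * real m powr (\<delta> - 1)"
          using m1[of m] m by (simp add: m0_def mult_ac)
      qed (use C ln1 in \<open>auto simp: m0_def\<close>)
      also have "(\<Sum>m=1..n. C * ln (real n) * real m powr (\<delta> - 1))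
          = C * ln (real n) * (\<Sum>m=1..n. real m powr (\<delta> - 1))"
        by (simp add: sum_distrib_left)
      also have "\<dots> \<le> C * ln (real n) * (real n powr \<delta> / \<delta>)"
        using C ln1 by (intro mult_left_mono sum_powr_le \<delta>) auto
      also have "S0 \<le> S0 * (real n powr \<delta> * ln (real n))"
      proof -
        have "1 * 1 \<le> real n powr \<delta> * ln (real n)"
          using n \<delta> ln1 by (intro mult_mono) (auto simp: ge_one_powr_ge_zero)
        thus ?thesis using mult_left_mono[of 1 _ S0] by (simp add: S0_def sum_nonneg)
      qed
      finally show ?thesis by (simp add: algebra_simps)
    qed
    show "\<bar>\<mu> j\<bar> \<le> (C * (1 + 1 / (1 - \<delta>))) * (real n powr \<delta> * ln (real n)) / real n"
      if "n \<ge> m0" and j: "j \<ge> n" for n j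
    proof -
      have n: "n \<ge> 3" using that by (simp add: m0_def)
      note ln1 = one_le_ln_nat[OF n]
      define \<epsilon> where "\<epsilon> = 1 - \<delta>"
      have \<epsilon>: "0 < \<epsilon>" using \<delta> by (simp add: \<epsilon>_def)
      have "ln (real j) = ln (real n) + ln (real j / real n)"
        using n j by (simp add: ln_div)
      also have "ln (real j / real n) \<le> (real j / real n) powr \<epsilon> / \<epsilon>"
        using n j \<epsilon> by (intro ln_powr_bound) auto
      finally have "real j powr (- \<epsilon>) * ln (real j)
          \<le> real j powr (- \<epsilon>) * (ln (real n) + (real j / real n) powr \<epsilon> / \<epsilon>)"
        by (intro mult_left_mono) auto
      also have "\<dots> = real j powr (- \<epsilon>) * ln (real n) + real n powr (- \<epsilon>) / \<epsilon>"
        using n j \<epsilon> by (simp add: powr_divide powr_minus field_simps)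
      also have "\<dots> \<le> real n powr (- \<epsilon>) * ln (real n) + real n powr (- \<epsilon>) * ln (real n) / \<epsilon>"
        using n j \<epsilon> ln1 by (intro add_mono mult_right_mono divide_right_mono powr_mono2') auto
      also have "\<dots> = (1 + 1 / \<epsilon>) * (real n powr (- \<epsilon>) * ln (real n))" by (simp add: distrib_right)
      also have "real n powr (- \<epsilon>) = real n powr \<delta> / real n"
        using n by (simp add: \<epsilon>_def powr_diff)
      finally have "C * (real j powr (- \<epsilon>) * ln (real j))
          \<le> C * ((1 + 1 / \<epsilon>) * (real n powr \<delta> / real n * ln (real n)))"
        by (rule mult_left_mono[OF _ C])
      moreover have "\<bar>\<mu> j\<bar> \<le> C * (real j powr (- \<epsilon>) * ln (real j))"
        using m1[of j] that by (simp add: m0_def \<epsilon>_def mult_ac)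
      ultimately show ?thesis by (simp add: \<epsilon>_def mult_ac)
    qed
    show "0 \<le> real n powr \<delta> * ln (real n)" if "n \<ge> m0" for n
      using that one_le_ln_nat[of n] by (simp add: m0_def)
  qed
qed

lemma quad_error_bigo:
  assumes s: "s > 0" and I: "I \<in> {clenshaw_curtis, fejer1, fejer2}"
    and w: "set_integrable lborel {-1..1} w" and f: "is_cheb_series_sum f" "f \<in> cheb_X s"
    and \<phi>: "moment_growth (moment w) \<phi>"
  shows "quad_error I w f \<in> O(\<lambda>n. real n powr (- s - 1) * \<phi> n)"
proof -
  obtain A where "\<forall>\<^sub>F j in sequentially. norm (cheb_coeff f j) \<le> A * norm (real j powr (- s - 1))"
    using f(2) unfolding cheb_X_def by (auto elim!: landau_o.bigE)
  then obtain J where J: "\<And>j. j \<ge> J \<Longrightarrow> \<bar>cheb_coeff f j\<bar> \<le> A * real j powr (- s - 1)"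
    unfolding eventually_sequentially by auto
  obtain C where C: "\<forall>\<^sub>F n in sequentially.
     (\<Sum>m<n. \<bar>moment w m\<bar>) \<le> C * \<phi> n \<and> (\<forall>j\<ge>n. \<bar>moment w j\<bar> \<le> C * \<phi> n / real n)"
    using \<phi> unfolding moment_growth_def by blast
  define c1 where "c1 = 2 powr (s + 1) / s"
  define c2 where "c2 = 8 * 2 powr (s + 1) * (\<Sum>q. real (Suc q) powr (- s - 1))"
  have c2: "0 \<le> c2"
    unfolding c2_def by (intro mult_nonneg_nonneg suminf_nonneg summable_Suc_powr s) auto
  have "\<forall>\<^sub>F n in sequentially. norm (quad_error I w f n)
      \<le> \<bar>A * C * (c1 + c2)\<bar> * norm (real n powr (- s - 1) * \<phi> n)"
    using C eventually_ge_at_top[of "max 2 J"]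
  proof eventually_elim
    case (elim n)
    hence n: "n \<ge> 2" "n \<ge> J" by auto
    have A0: "0 \<le> A * real n powr (- s - 1)" using J[OF n(2)] by linarith
    have "\<bar>quad_error I w f n\<bar> \<le> A * (c1 * real n powr (- s) * (C * \<phi> n / real n)
        + c2 * real n powr (- s - 1) * (\<Sum>m<n. \<bar>moment w m\<bar>))"
      unfolding c1_def c2_def using elim n J by (intro quad_error_le[OF s I n(1) w f(1)]) auto
    also have "\<dots> = (A * real n powr (- s - 1)) * (c1 * (C * \<phi> n) + c2 * (\<Sum>m<n. \<bar>moment w m\<bar>))"
      using n by (simp add: powr_diff field_simps)
    also have "\<dots> \<le> (A * real n powr (- s - 1)) * (c1 * (C * \<phi> n) + c2 * (C * \<phi> n))"
      using elim by (intro mult_left_mono[OF _ A0] add_left_mono mult_left_mono[OF _ c2]) auto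
    also have "\<dots> = (A * C * (c1 + c2)) * (real n powr (- s - 1) * \<phi> n)" by (simp add: algebra_simps)
    also have "\<dots> \<le> \<bar>A * C * (c1 + c2)\<bar> * \<bar>real n powr (- s - 1) * \<phi> n\<bar>"
      by (metis abs_ge_self abs_mult)
    finally show ?case by simp
  qed
  thus ?thesis by (rule bigoI)
qed

lemma moment_growth_jacobi:
  assumes \<alpha>\<beta>: "\<alpha> > - 1" "\<beta> > - 1"
  shows "min \<alpha> \<beta> \<ge> - (1/2) \<Longrightarrow> moment_growth (moment (jacobi_weight \<alpha> \<beta>)) (\<lambda>_. 1)"
    and "min \<alpha> \<beta> < - (1/2) \<Longrightarrow>
      moment_growth (moment (jacobi_weight \<alpha> \<beta>)) (\<lambda>n. real n powr (- 1 - 2 * min \<alpha> \<beta>))"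
proof -
  define \<kappa> where "\<kappa> = min (pow_order (2 * \<alpha> + 1)) (pow_order (2 * \<beta> + 1))"
  obtain C where C: "\<And>m. m \<ge> 1 \<Longrightarrow> \<bar>moment (jacobi_weight \<alpha> \<beta>) m\<bar> \<le> C * real m powr (- 1 - \<kappa>)"
    using jacobi_moment_bound[OF \<alpha>\<beta>] unfolding \<kappa>_def by blast
  show "moment_growth (moment (jacobi_weight \<alpha> \<beta>)) (\<lambda>_. 1)" if "min \<alpha> \<beta> \<ge> - (1/2)"
  proof (rule moment_growth_summable[OF _ C])
    have "0 < pow_order p" if "0 \<le> p" for p using that by (auto simp: pow_order_def)
    thus "\<kappa> > 0" using that by (simp add: \<kappa>_def)
  qed
  show "moment_growth (moment (jacobi_weight \<alpha> \<beta>)) (\<lambda>n. real n powr (- 1 - 2 * min \<alpha> \<beta>))"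
    if "min \<alpha> \<beta> < - (1/2)"
  proof -
    have \<kappa>: "\<kappa> = 2 * min \<alpha> \<beta> + 1"
      using that by (auto simp: \<kappa>_def pow_order_def min_def)
    show ?thesis
    proof (rule moment_growth_powr)
      show "\<bar>moment (jacobi_weight \<alpha> \<beta>) m\<bar> \<le> C * real m powr (- 1 - 2 * min \<alpha> \<beta> - 1)" if "m \<ge> 1" for m
        using C[OF that] by (simp add: \<kappa> algebra_simps)
    qed (use that \<alpha>\<beta> in auto)
  qed
qed

lemma moment_growth_log_jacobi:
  assumes \<alpha>\<beta>: "\<alpha> > - 1" "\<beta> > - 1"
  shows "\<beta> > - (1/2) \<Longrightarrow> moment_growth (moment (log_jacobi_weight \<alpha> \<beta>)) (\<lambda>_. 1)"
    and "\<beta> \<le> - (1/2) \<Longrightarrow>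
      moment_growth (moment (log_jacobi_weight \<alpha> \<beta>)) (\<lambda>n. real n powr (- 1 - 2 * \<beta>) * ln (real n))"
proof -
  define b where "b = 2 * \<beta> + 1"
  define M where "M = moment (log_jacobi_weight \<alpha> \<beta>)"
  have b: "b > - 1" using \<alpha>\<beta> by (simp add: b_def)
  obtain C where C: "0 \<le> C" "\<And>\<eta> \<kappa> m. m \<ge> 1 \<Longrightarrow> 0 < \<eta> \<Longrightarrow> \<eta> \<le> 1 \<Longrightarrow> - 1 < \<kappa> \<Longrightarrow> \<kappa> \<le> 1 / 2 \<Longrightarrow>
      \<kappa> \<le> b \<Longrightarrow> b = 0 \<and> \<eta> = 1 \<or> \<kappa> \<le> b - \<eta> \<Longrightarrow>
      \<bar>M m\<bar> \<le> C / (\<eta> * (1 + \<kappa>)) * real m powr (- 1 - \<kappa>)"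
    using log_jacobi_moment_bound[OF \<alpha>\<beta>] unfolding b_def M_def by metis
  show "moment_growth M (\<lambda>_. 1)" if "\<beta> > - (1/2)"
  proof -
    have b0: "b > 0" using that by (simp add: b_def)
    \<comment> \<open>Half of the available exponent pays for the logarithm; the other half keeps the moments summable.\<close>
    define \<eta> \<kappa> where "\<eta> = min b 1 / 2" and "\<kappa> = min (1 / 2) (b / 2)"
    have \<eta>: "0 < \<eta>" "\<eta> \<le> 1" and \<kappa>: "0 < \<kappa>" "\<kappa> \<le> 1 / 2" "\<kappa> \<le> b" "\<kappa> \<le> b - \<eta>"
      using b0 by (auto simp: \<eta>_def \<kappa>_def min_def)
    show ?thesis
    proof (rule moment_growth_summable[OF \<kappa>(1)])
      show "\<bar>M m\<bar> \<le> C / (\<eta> * (1 + \<kappa>)) * real m powr (- 1 - \<kappa>)" if "m \<ge> 1" for m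
        using that \<eta> \<kappa> by (intro C(2)) auto
    qed
  qed
  show "moment_growth M (\<lambda>n. real n powr (- 1 - 2 * \<beta>) * ln (real n))" if \<beta>: "\<beta> \<le> - (1/2)"
  proof (cases "\<beta> = - (1/2)")
    case True
    have "moment_growth M (\<lambda>n. ln (real n))"
    proof (rule moment_growth_ln)
      show "\<bar>M m\<bar> \<le> C / real m" if "m \<ge> 1" for m
        using C(2)[of m 1 0] that True by (simp add: b_def powr_minus_divide)
    qed
    hence "moment_growth M (\<lambda>n. real n powr 0 * ln (real n))"
      unfolding moment_growth_def
      by (elim ex_forward eventually_rev_mp) (auto intro!: eventually_sequentiallyI[of 1])
    thus ?thesis using True by simp
  next
    case False
    hence b0: "b < 0" using \<beta> by (simp add: b_def)
    define C' where "C' = C * exp 1 * (2 / (1 + b))"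
    have C'0: "0 \<le> C'" using C(1) b by (simp add: C'_def)
    have "\<forall>\<^sub>F m in sequentially. \<bar>M m\<bar> \<le> C' * real m powr (- b - 1) * ln (real m)"
    proof (rule eventually_sequentiallyI)
      fix m :: nat assume "m \<ge> nat \<lceil>exp (2 / (1 + b))\<rceil>"
      hence m: "exp (2 / (1 + b)) \<le> real m" by linarith
      moreover have "0 < exp (2 / (1 + b))" by simp
      ultimately have "0 < real m" by linarith
      hence m1: "m \<ge> 1" by simp
      have lm: "2 / (1 + b) \<le> ln (real m)" using m m1 by (simp add: ln_ge_iff)
      moreover have "2 \<le> 2 / (1 + b)" using b b0 by (simp add: field_simps)
      ultimately have l: "2 \<le> ln (real m)" by linarith
      \<comment> \<open>This choice makes \<open>m powr \<eta>\<close> the constant \<open>exp 1\<close>, while \<open>1/\<eta>\<close> is the expected factor \<open>ln m\<close>.\<close>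
      define \<eta> where "\<eta> = 1 / ln (real m)"
      have \<eta>: "0 < \<eta>" "\<eta> \<le> 1" "\<eta> \<le> (1 + b) / 2"
        using l lm b by (auto simp: \<eta>_def field_simps)
      have "\<bar>M m\<bar> \<le> C / (\<eta> * (1 + (b - \<eta>))) * real m powr (- 1 - (b - \<eta>))"
        using m1 \<eta> b b0 by (intro C(2)) auto
      also have "real m powr (- 1 - (b - \<eta>)) = real m powr (- b - 1) * exp 1"
      proof -
        have "m \<noteq> 1" using l by (intro notI) simp
        hence "real m powr \<eta> = exp 1" using m1 by (simp add: powr_def \<eta>_def)
        moreover have "real m powr (- 1 - (b - \<eta>)) = real m powr (- b - 1) * real m powr \<eta>"
          by (simp add: algebra_simps flip: powr_add)
        ultimately show ?thesis by simp
      qed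
      also have "C / (\<eta> * (1 + (b - \<eta>))) * (real m powr (- b - 1) * exp 1)
          \<le> C / (\<eta> * ((1 + b) / 2)) * (real m powr (- b - 1) * exp 1)"
        using C(1) \<eta> b by (intro mult_right_mono divide_left_mono mult_left_mono mult_pos_pos) auto
      also have "C / (\<eta> * ((1 + b) / 2)) = C * (2 / (1 + b)) * ln (real m)" by (simp add: \<eta>_def)
      finally show "\<bar>M m\<bar> \<le> C' * real m powr (- b - 1) * ln (real m)"
        by (simp add: C'_def mult_ac)
    qed
    hence "moment_growth M (\<lambda>n. real n powr (- b) * ln (real n))"
      using b b0 by (intro moment_growth_powr_ln[OF _ _ C'0]) auto
    thus ?thesis by (simp add: b_def algebra_simps)
  qed
qed

theorem theorem3p5:
  fixes s \<alpha> \<beta> :: real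
    and f :: "real \<Rightarrow> real"
    and I :: "(real \<Rightarrow> real) \<Rightarrow> nat \<Rightarrow> (real \<Rightarrow> real) \<Rightarrow> real"
  assumes "s > 0"
    and "f \<in> cheb_X s"
    and "is_cheb_series_sum f"
    and "\<alpha> > -1" and "\<beta> > -1"
    and "I \<in> {clenshaw_curtis, fejer1, fejer2}"
  shows
    "((min \<alpha> \<beta> \<ge> - (1/2) \<longrightarrow>
        quad_error I (jacobi_weight \<alpha> \<beta>) f \<in> O(\<lambda>n. real n powr (- s - 1))) \<and>
      (-1 < min \<alpha> \<beta> \<and> min \<alpha> \<beta> < - (1/2) \<longrightarrow>
        quad_error I (jacobi_weight \<alpha> \<beta>) f \<in> O(\<lambda>n. real n powr (- s - 2 - 2 * min \<alpha> \<beta>)))) \<and>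
     ((\<beta> > - (1/2) \<longrightarrow>
        quad_error I (log_jacobi_weight \<alpha> \<beta>) f \<in> O(\<lambda>n. real n powr (- s - 1))) \<and>
      (-1 < \<beta> \<and> \<beta> \<le> - (1/2) \<longrightarrow>
        quad_error I (log_jacobi_weight \<alpha> \<beta>) f
          \<in> O(\<lambda>n. real n powr (- s - 2 - 2 * \<beta>) * ln (real n))))"
proof -
  note wj = set_integrable_jacobi_weight[OF assms(4,5)]
  note wl = set_integrable_log_jacobi_weight[OF assms(4,5)]
  note gj = moment_growth_jacobi[OF assms(4,5)] and gl = moment_growth_log_jacobi[OF assms(4,5)]
  note error = quad_error_bigo[OF assms(1,6) _ assms(3,2)]
  have exponent: "real n powr (- s - 1) * real n powr (- 1 - 2 * x) = real n powr (- s - 2 - 2 * x)" for n x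
    by (simp add: algebra_simps flip: powr_add)
  show ?thesis
    using error[OF wj gj(1)] error[OF wj gj(2)] error[OF wl gl(1)] error[OF wl gl(2)]
    by (simp add: exponent mult.assoc[symmetric])
qed

end
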